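(* Let $Y$ be a Banach sequence lattice, $X$ a Banach lattice and $E$ a Banach space. Then: (i) A linear operator $T:E\to X$ is $Y$-convex if and only if the associated operator $\widetilde{T}:\ell_{00}^{Y}(E)\to\ell_{00}^{\tau,Y}(X)$ is bounded, in which case $\|\widetilde{T}\|=\|T\|_{\mathcal{K}^{Y}}$. (ii) A linear operator $S:X\to E$ is $Y$-concave if and only if the associated operator $\widetilde{S}:\ell_{00}^{\tau,Y}(X)\to\ell_{00}^{Y}(E)$ is bounded, in which case $\|\widetilde{S}\|=\|S\|_{\mathcal{K}_{Y}}$.
   Context: All vector spaces are real. A Banach sequence lattice is a linear subspace $Y\subset\mathbb{R}^{\mathbb{N}}$ containing all canonical sequences $e_n$, with a complete norm $\|\cdot\|_Y$ such that if $f\in\mathbb{R}^{\mathbb{N}}$, $g\in Y$ and $|f|\le|g|$ pointwise, then $f\in Y$ and $\|f\|_Y\le\|g\|_Y$. A finite tuple $(t_1,\dots,t_n)\in\mathbb{R}^n$ is identified with $(t_1,\dots,t_n,0,0,\dots)\in Y$. Krivine's functional calculus: let $\mathcal{H}_n$ be the space of continuous $h:\mathbb{R}^n\to\mathbb{R}$ with $h(\lambda t)=\lambda h(t)$ for $\lambda\ge0$, with the pointwise order. For a Banach lattice $X$ and $x=(x_1,\dots,x_n)\in X^n$ there is a unique linear map $\tau_{n,x}:\mathcal{H}_n\to X$ with $\tau_{n,x}(\pi_{n,j})=x_j$ for each coordinate projection $\pi_{n,j}$ and $\tau_{n,x}(h_1\vee h_2)=\tau_{n,x}(h_1)\vee\tau_{n,x}(h_2)$.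 Write $\|(x_1,\dots,x_n)\|_Y:=\tau_{n,x}\big(t\mapsto\|(t_1,\dots,t_n)\|_Y\big)\in X$ and $\|(x_1,\dots,x_n)\|_{X^n,Y,\tau}:=\big\|\,\|(x_1,\dots,x_n)\|_Y\big\|_X\in\mathbb{R}$. For a Banach space $E$ write $\|(w_1,\dots,w_n)\|_{E^n,Y}:=\|(\|w_1\|_E,\dots,\|w_n\|_E)\|_Y$. A linear operator $T:E\to X$ is $Y$-convex if there is a constant $C>0$ with $\|(Tw_1,\dots,Tw_n)\|_{X^n,Y,\tau}\le C\|(w_1,\dots,w_n)\|_{E^n,Y}$ for all $n\in\mathbb{N}$, $w_1,\dots,w_n\in E$; the smallest such constant (infimum of all such $C$) is $\|T\|_{\mathcal{K}^Y}$. A linear operator $S:X\to E$ is $Y$-concave if there is $K>0$ with $\|(Sx_1,\dots,Sx_n)\|_{E^n,Y}\le K\|(x_1,\dots,x_n)\|_{X^n,Y,\tau}$ for all $n\in\mathbb{N}$, $x_1,\dots,x_n\in X$; the smallest such constant (infimum) is $\|S\|_{\mathcal{K}_Y}$. $\ell^{Y}(E):=\{\{w_j\}\in E^{\mathbb{N}}:\{\|w_j\|_E\}_j\in Y\}$ with norm $\|\{w_j\}\|_{\ell^Y(E)}:=\|\{\|w_j\|_E\}_{j}\|_Y$. $\ell^{\tau,Y}(X):=\{\{x_j\}\in X^{\mathbb{N}}:\sup_{n}\|(x_1,\dots,x_n)\|_{X^n,Y,\tau}<\infty\}$ with norm $\|\{x_j\}\|_{\ell^{\tau,Y}(X)}:=\sup_n\|(x_1,\dots,x_n)\|_{X^n,Y,\tau}$.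 The subspaces of eventually zero sequences are $\ell_{00}^{Y}(E)$ and $\ell_{00}^{\tau,Y}(X)$, with the restricted norms. For a linear operator $T:V\to W$ between vector spaces, the associated operator $\widetilde{T}:V^{\mathbb{N}}\to W^{\mathbb{N}}$ is $\widetilde{T}(\{v_j\}_{j=1}^\infty):=\{Tv_j\}_{j=1}^\infty$; the same symbol denotes its restrictions to subspaces. *)

theory Defs
  imports "HOL-Analysis.Analysis"
begin

class banach_lattice = banach + ordered_real_vector + lattice +
  assumes norm_mono_modulus: "sup x (- x) \<le> sup y (- y) \<Longrightarrow> norm x \<le> norm y"

locale banach_sequence_lattice =
  fixes Y :: "(nat \<Rightarrow> real) set" and normY :: "(nat \<Rightarrow> real) \<Rightarrow> real"
  assumes unit_mem: "(\<lambda>j. if j = k then 1 else 0) \<in> Y"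
    and add_mem: "f \<in> Y \<Longrightarrow> g \<in> Y \<Longrightarrow> (\<lambda>j. f j + g j) \<in> Y"
    and scale_mem: "f \<in> Y \<Longrightarrow> (\<lambda>j. c * f j) \<in> Y"
    and norm_eq_zero: "f \<in> Y \<Longrightarrow> normY f = 0 \<longleftrightarrow> f = (\<lambda>j. 0)"
    and norm_triangle: "f \<in> Y \<Longrightarrow> g \<in> Y \<Longrightarrow> normY (\<lambda>j. f j + g j) \<le> normY f + normY g"
    and norm_scale: "f \<in> Y \<Longrightarrow> normY (\<lambda>j. c * f j) = \<bar>c\<bar> * normY f"
    and complete: "(\<And>n. F n \<in> Y) \<Longrightarrow>
      (\<And>e. e > 0 \<Longrightarrow> \<exists>M. \<forall>m\<ge>M. \<forall>n\<ge>M. normY (\<lambda>j. F m j - F n j) < e) \<Longrightarrow>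
      \<exists>g\<in>Y. (\<lambda>n. normY (\<lambda>j. F n j - g j)) \<longlonglongrightarrow> 0"
    and solid: "g \<in> Y \<Longrightarrow> (\<And>j. \<bar>f j\<bar> \<le> \<bar>g j\<bar>) \<Longrightarrow> f \<in> Y \<and> normY f \<le> normY g"

text \<open>
  An \<open>n\<close>-tuple is represented by the entries with index \<open>j < n\<close> of a sequence (indices start
  at 0); the remaining entries are irrelevant.  The function \<open>trunc n\<close> yields the identification
  of a tuple with a finitely supported sequence.  The case \<open>n = 0\<close> is not excluded below; the
  space of homogeneous functions is then \<open>{0}\<close>, so that it only adds trivial conditions.
\<close>

definition trunc :: "nat \<Rightarrow> (nat \<Rightarrow> 'a::zero) \<Rightarrow> nat \<Rightarrow> 'a" where
  "trunc n t = (\<lambda>j. if j < n then t j else 0)"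

text \<open>
  A function on \<open>\<real>\<^sup>n\<close> is represented by the function on real sequences that depends
  on the first \<open>n\<close> coordinates only.  Continuity refers to the product topology, so for such
  functions it is continuity on \<open>\<real>\<^sup>n\<close>.
\<close>

definition homog_funs :: "nat \<Rightarrow> ((nat \<Rightarrow> real) \<Rightarrow> real) set" where
  "homog_funs n = {h. continuous_on UNIV h \<and> (\<forall>t. h (trunc n t) = h t) \<and>
     (\<forall>c\<ge>0. \<forall>t. h (\<lambda>j. c * t j) = c * h t)}"

text \<open>The condition of being extensional only fixes the values outside \<open>homog_funs n\<close>.\<close>

definition is_krivine_map ::
    "nat \<Rightarrow> (nat \<Rightarrow> 'x::banach_lattice) \<Rightarrow> (((nat \<Rightarrow> real) \<Rightarrow> real) \<Rightarrow> 'x) \<Rightarrow> bool" where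
  "is_krivine_map n x \<tau> \<longleftrightarrow>
     \<tau> \<in> extensional (homog_funs n) \<and>
     (\<forall>h1\<in>homog_funs n. \<forall>h2\<in>homog_funs n. \<tau> (\<lambda>t. h1 t + h2 t) = \<tau> h1 + \<tau> h2) \<and>
     (\<forall>h\<in>homog_funs n. \<forall>c. \<tau> (\<lambda>t. c * h t) = c *\<^sub>R \<tau> h) \<and>
     (\<forall>j<n. \<tau> (\<lambda>t. t j) = x j) \<and>
     (\<forall>h1\<in>homog_funs n. \<forall>h2\<in>homog_funs n. \<tau> (\<lambda>t. max (h1 t) (h2 t)) = sup (\<tau> h1) (\<tau> h2))"

definition krivine ::
    "nat \<Rightarrow> (nat \<Rightarrow> 'x::banach_lattice) \<Rightarrow> ((nat \<Rightarrow> real) \<Rightarrow> real) \<Rightarrow> 'x" where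
  "krivine n x = (THE \<tau>. is_krivine_map n x \<tau>)"

definition lattice_tuple_norm ::
    "((nat \<Rightarrow> real) \<Rightarrow> real) \<Rightarrow> nat \<Rightarrow> (nat \<Rightarrow> 'x::banach_lattice) \<Rightarrow> real" where
  "lattice_tuple_norm normY n x = norm (krivine n x (\<lambda>t. normY (trunc n t)))"

definition banach_tuple_norm ::
    "((nat \<Rightarrow> real) \<Rightarrow> real) \<Rightarrow> nat \<Rightarrow> (nat \<Rightarrow> 'e::banach) \<Rightarrow> real" where
  "banach_tuple_norm normY n w = normY (trunc n (\<lambda>j. norm (w j)))"

definition convex_bound ::
    "((nat \<Rightarrow> real) \<Rightarrow> real) \<Rightarrow> ('e::banach \<Rightarrow> 'x::banach_lattice) \<Rightarrow> real \<Rightarrow> bool" where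
  "convex_bound normY T C \<longleftrightarrow> C > 0 \<and>
     (\<forall>n w. lattice_tuple_norm normY n (\<lambda>j. T (w j)) \<le> C * banach_tuple_norm normY n w)"

definition Y_convex ::
    "((nat \<Rightarrow> real) \<Rightarrow> real) \<Rightarrow> ('e::banach \<Rightarrow> 'x::banach_lattice) \<Rightarrow> bool" where
  "Y_convex normY T \<longleftrightarrow> (\<exists>C. convex_bound normY T C)"

definition convexity_const ::
    "((nat \<Rightarrow> real) \<Rightarrow> real) \<Rightarrow> ('e::banach \<Rightarrow> 'x::banach_lattice) \<Rightarrow> real" where
  "convexity_const normY T = Inf {C. convex_bound normY T C}"

definition concave_bound ::
    "((nat \<Rightarrow> real) \<Rightarrow> real) \<Rightarrow> ('x::banach_lattice \<Rightarrow> 'e::banach) \<Rightarrow> real \<Rightarrow> bool" where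
  "concave_bound normY S K \<longleftrightarrow> K > 0 \<and>
     (\<forall>n x. banach_tuple_norm normY n (\<lambda>j. S (x j)) \<le> K * lattice_tuple_norm normY n x)"

definition Y_concave ::
    "((nat \<Rightarrow> real) \<Rightarrow> real) \<Rightarrow> ('x::banach_lattice \<Rightarrow> 'e::banach) \<Rightarrow> bool" where
  "Y_concave normY S \<longleftrightarrow> (\<exists>K. concave_bound normY S K)"

definition concavity_const ::
    "((nat \<Rightarrow> real) \<Rightarrow> real) \<Rightarrow> ('x::banach_lattice \<Rightarrow> 'e::banach) \<Rightarrow> real" where
  "concavity_const normY S = Inf {K. concave_bound normY S K}"

definition ell :: "(nat \<Rightarrow> real) set \<Rightarrow> (nat \<Rightarrow> 'e::banach) set" where
  "ell Y = {w. (\<lambda>j. norm (w j)) \<in> Y}"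

definition ell_norm :: "((nat \<Rightarrow> real) \<Rightarrow> real) \<Rightarrow> (nat \<Rightarrow> 'e::banach) \<Rightarrow> real" where
  "ell_norm normY w = normY (\<lambda>j. norm (w j))"

definition ell_tau :: "((nat \<Rightarrow> real) \<Rightarrow> real) \<Rightarrow> (nat \<Rightarrow> 'x::banach_lattice) set" where
  "ell_tau normY = {x. bdd_above (range (\<lambda>n. lattice_tuple_norm normY n x))}"

definition ell_tau_norm :: "((nat \<Rightarrow> real) \<Rightarrow> real) \<Rightarrow> (nat \<Rightarrow> 'x::banach_lattice) \<Rightarrow> real" where
  "ell_tau_norm normY x = (SUP n. lattice_tuple_norm normY n x)"

definition ell00 :: "(nat \<Rightarrow> real) set \<Rightarrow> (nat \<Rightarrow> 'e::banach) set" where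
  "ell00 Y = {w \<in> ell Y. \<forall>\<^sub>F j in sequentially. w j = 0}"

definition ell00_tau :: "((nat \<Rightarrow> real) \<Rightarrow> real) \<Rightarrow> (nat \<Rightarrow> 'x::banach_lattice) set" where
  "ell00_tau normY = {x \<in> ell_tau normY. \<forall>\<^sub>F j in sequentially. x j = 0}"

definition seq_op :: "('v \<Rightarrow> 'w) \<Rightarrow> (nat \<Rightarrow> 'v) \<Rightarrow> nat \<Rightarrow> 'w" where
  "seq_op T v = (\<lambda>j. T (v j))"

text \<open>
  Boundedness and operator norm for a map between carrier sets equipped with norms; these are
  the relativised versions of \<^const>\<open>bounded_linear\<close> (without linearity, which \<open>seq_op T\<close>
  inherits from \<open>T\<close>) and \<^const>\<open>onorm\<close>.  As in \<^const>\<open>onorm\<close>, the zero vector contributes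
  \<open>0 / 0 = 0\<close> to the supremum.
\<close>

definition bounded_op_on ::
    "'a set \<Rightarrow> ('a \<Rightarrow> real) \<Rightarrow> 'b set \<Rightarrow> ('b \<Rightarrow> real) \<Rightarrow> ('a \<Rightarrow> 'b) \<Rightarrow> bool" where
  "bounded_op_on V nV W nW F \<longleftrightarrow> F ` V \<subseteq> W \<and> (\<exists>C. \<forall>v\<in>V. nW (F v) \<le> C * nV v)"

definition op_norm_on ::
    "'a set \<Rightarrow> ('a \<Rightarrow> real) \<Rightarrow> ('b \<Rightarrow> real) \<Rightarrow> ('a \<Rightarrow> 'b) \<Rightarrow> real" where
  "op_norm_on V nV nW F = (SUP v\<in>V. nW (F v) / nV v)"

end

theory Submission
  imports Defs
begin

text \<open>
  Truncating sequences turns boundedness of the associated operator into the convexity or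
  concavity inequality, provided the norm of a tuple in \<open>X\<close> is monotone in its length
  and does not change when zeros are appended.  Both facts come from the uniqueness of Krivine's
  calculus: the calculus for \<open>n\<close> variables restricts to the one for fewer variables, and composing
  with truncation yields the one for a tuple padded with zeros.

  Uniqueness holds because the lattice generated by the coordinates is dense in the homogeneous
  functions.  For existence, every element of that lattice is a difference of two maxima of linear
  forms, and an inequality between such maxima on \<open>\<real>\<^sup>n\<close> carries over to \<open>X\<close> because it amounts to
  convex dependence of the forms; the resulting map extends by completeness.
\<close>

section \<open>Lattice form of the Stone--Weierstrass theorem\<close>

text \<open>Compactness is used twice. For fixed \<open>s\<close>, an interpolant at
  \<open>s\<close> and \<open>t\<close> stays below \<open>h + e\<close> near \<open>t\<close>, so a
  finite minimum of interpolants does so on all of \<open>K\<close> and still equals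
  \<open>h\<close> at \<open>s\<close>. A finite maximum of such minima over \<open>s\<close> also
  exceeds \<open>h - e\<close>.\<close>

lemma lattice_stone_weierstrass:
  fixes K :: "'a::topological_space set" and L :: "('a \<Rightarrow> real) set"
  assumes "compact K" and contL: "\<And>f. f \<in> L \<Longrightarrow> continuous_on UNIV f"
    and maxL: "\<And>f g. f \<in> L \<Longrightarrow> g \<in> L \<Longrightarrow> (\<lambda>t. max (f t) (g t)) \<in> L"
    and minL: "\<And>f g. f \<in> L \<Longrightarrow> g \<in> L \<Longrightarrow> (\<lambda>t. min (f t) (g t)) \<in> L"
    and ip: "\<And>s t. s \<in> K \<Longrightarrow> t \<in> K \<Longrightarrow> \<exists>f\<in>L. f s = h s \<and> f t = h t"
    and "L \<noteq> {}" and conth: "continuous_on UNIV h" and e: "e > 0"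
  shows "\<exists>f\<in>L. \<forall>t\<in>K. \<bar>h t - f t\<bar> < e"
proof (cases "K = {}")
  case True
  then show ?thesis using \<open>L \<noteq> {}\<close> by auto
next
  case False
  \<comment> \<open>The minimum is recorded as attained at each point, so that a property common to
    all \<open>F i\<close> at a point, such as the value \<open>h s\<close>, passes to it.\<close>
  have finmin: "\<exists>f\<in>L. (\<forall>i\<in>I. \<forall>t. f t \<le> F i t) \<and> (\<forall>t. \<exists>i\<in>I. f t = F i t)"
    if "finite I" "I \<noteq> {}" "\<forall>i\<in>I. F i \<in> L" for I :: "'a set" and F
    using that
  proof (induction rule: finite_ne_induct)
    case (singleton x)
    then show ?case by auto
  next
    case (insert x J)
    then obtain f where f: "f \<in> L" "\<forall>i\<in>J. \<forall>t. f t \<le> F i t" "\<forall>t. \<exists>i\<in>J. f t = F i t" by auto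
    have "F x \<in> L" using insert by auto
    show ?case
      by (rule bexI[OF _ minL[OF \<open>F x \<in> L\<close> f(1)]])
        (use f in \<open>auto simp: min_def intro: order_trans; meson le_cases order_trans\<close>)
  qed
  have finmax: "\<exists>f\<in>L. (\<forall>i\<in>I. \<forall>t. F i t \<le> f t) \<and> (\<forall>t. \<exists>i\<in>I. f t = F i t)"
    if "finite I" "I \<noteq> {}" "\<forall>i\<in>I. F i \<in> L" for I :: "'a set" and F
    using that
  proof (induction rule: finite_ne_induct)
    case (singleton x)
    then show ?case by auto
  next
    case (insert x J)
    then obtain f where f: "f \<in> L" "\<forall>i\<in>J. \<forall>t. F i t \<le> f t" "\<forall>t. \<exists>i\<in>J. f t = F i t" by auto
    have "F x \<in> L" using insert by auto
    show ?case
      by (rule bexI[OF _ maxL[OF \<open>F x \<in> L\<close> f(1)]])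
        (use f in \<open>auto simp: max_def intro: order_trans; meson le_cases order_trans\<close>)
  qed
  have one: "\<exists>f\<in>L. f s = h s \<and> (\<forall>t\<in>K. f t < h t + e)" if s: "s \<in> K" for s
  proof -
    have "\<forall>t\<in>K. \<exists>f. f \<in> L \<and> f s = h s \<and> f t = h t" using ip[OF s] by blast
    then obtain F where F: "\<And>t. t \<in> K \<Longrightarrow> F t \<in> L \<and> F t s = h s \<and> F t t = h t" by metis
    have op: "open {r. F t r < h r + e}" if "t \<in> K" for t
      by (intro open_Collect_less continuous_intros conth contL) (use F that in auto)
    have cov: "K \<subseteq> (\<Union>t\<in>K. {r. F t r < h r + e})" using F e by auto
    obtain C where C: "C \<subseteq> K" "finite C" "K \<subseteq> (\<Union>t\<in>C. {r. F t r < h r + e})"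
      using compactE_image[OF \<open>compact K\<close> op cov] by blast
    then have "C \<noteq> {}" using False by auto
    moreover have "\<forall>i\<in>C. F i \<in> L" using F C by auto
    ultimately obtain f where f: "f \<in> L" "\<forall>i\<in>C. \<forall>t. f t \<le> F i t" "\<forall>t. \<exists>i\<in>C. f t = F i t"
      using finmin[of C F] C by metis
    have "f s = h s" using f(3) F C by (metis subsetD)
    moreover have "f t < h t + e" if tK: "t \<in> K" for t
    proof -
      obtain i where "i \<in> C" "F i t < h t + e" using C(3) tK by blast
      then show ?thesis using f(2) le_less_trans by blast
    qed
    ultimately show ?thesis using f by auto
  qed
  then obtain F where F: "\<And>s. s \<in> K \<Longrightarrow> F s \<in> L \<and> F s s = h s \<and> (\<forall>t\<in>K. F s t < h t + e)"
    by metis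
  have op: "open {r. h r - e < F s r}" if "s \<in> K" for s
    by (intro open_Collect_less continuous_intros conth contL) (use F that in auto)
  have cov: "K \<subseteq> (\<Union>s\<in>K. {r. h r - e < F s r})" using F e by auto
  obtain C where C: "C \<subseteq> K" "finite C" "K \<subseteq> (\<Union>s\<in>C. {r. h r - e < F s r})"
    using compactE_image[OF \<open>compact K\<close> op cov] by blast
  then have "C \<noteq> {}" using False by auto
  moreover have "\<forall>i\<in>C. F i \<in> L" using F C by auto
  ultimately obtain f where f: "f \<in> L" "\<forall>i\<in>C. \<forall>t. F i t \<le> f t" "\<forall>t. \<exists>i\<in>C. f t = F i t"
    using finmax[of C F] C by metis
  have "\<bar>h t - f t\<bar> < e" if tK: "t \<in> K" for t
  proof -
    have "f t < h t + e" using f(3) F C tK by (metis subsetD)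
    moreover obtain i where "i \<in> C" "h t - e < F i t" using C(3) tK by blast
    then have "h t - e < f t" using f(2) less_le_trans by blast
    ultimately show ?thesis by linarith
  qed
  then show ?thesis using f by auto
qed

section \<open>Closure properties of positively homogeneous functions\<close>

lemma homog_funsD:
  assumes "h \<in> homog_funs n"
  shows "continuous_on UNIV h" "h (trunc n t) = h t" "c \<ge> 0 \<Longrightarrow> h (\<lambda>j. c * t j) = c * h t"
  using assms by (auto simp: homog_funs_def)

lemma homog_funs_zero: "(\<lambda>t. 0) \<in> homog_funs n"
  by (auto simp: homog_funs_def)

lemma homog_funs_proj: "j < n \<Longrightarrow> (\<lambda>t. t j) \<in> homog_funs n"
  by (auto simp: homog_funs_def trunc_def intro: continuous_on_product_coordinates)

lemma homog_funs_add:
  "f \<in> homog_funs n \<Longrightarrow> g \<in> homog_funs n \<Longrightarrow> (\<lambda>t. f t + g t) \<in> homog_funs n"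
  by (auto simp: homog_funs_def algebra_simps intro: continuous_intros)

lemma homog_funs_scale: "f \<in> homog_funs n \<Longrightarrow> (\<lambda>t. c * f t) \<in> homog_funs n"
  by (auto simp: homog_funs_def algebra_simps intro: continuous_intros)

lemma homog_funs_max:
  "f \<in> homog_funs n \<Longrightarrow> g \<in> homog_funs n \<Longrightarrow> (\<lambda>t. max (f t) (g t)) \<in> homog_funs n"
  by (auto simp: homog_funs_def max_mult_distrib_left intro: continuous_intros)

lemma homog_funs_mono: "h \<in> homog_funs m \<Longrightarrow> m \<le> n \<Longrightarrow> h \<in> homog_funs n"
proof -
  assume h: "h \<in> homog_funs m" and mn: "m \<le> n"
  have "h (trunc n t) = h t" for t
  proof -
    have "h (trunc n t) = h (trunc m (trunc n t))" by (simp add: homog_funsD[OF h])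
    also have "trunc m (trunc n t) = trunc m t" using mn by (auto simp: trunc_def)
    finally show ?thesis by (simp add: homog_funsD[OF h])
  qed
  then show ?thesis using h by (auto simp: homog_funs_def)
qed

text \<open>Truncation is continuous in the product topology and commutes with scalars. Later it
  sets the variables from \<open>n\<close> on to zero, as for a tuple padded with zeros.\<close>

lemma homog_funs_comp_trunc:
  assumes h: "h \<in> homog_funs m"
  shows "(\<lambda>t. h (trunc n t)) \<in> homog_funs n"
proof -
  have "continuous_on UNIV (trunc n :: (nat \<Rightarrow> real) \<Rightarrow> _)"
  proof (rule continuous_on_coordinatewise_then_product)
    show "continuous_on UNIV (\<lambda>t::nat \<Rightarrow> real. trunc n t j)" for j
      by (cases "j < n") (simp_all add: trunc_def)
  qed
  then have "continuous_on UNIV (h \<circ> trunc n)"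
    by (intro continuous_on_compose continuous_on_subset[OF homog_funsD(1)[OF h]]) auto
  moreover have "trunc n (trunc n t) = trunc n t" for t :: "nat \<Rightarrow> real"
    by (auto simp: trunc_def)
  moreover have "trunc n (\<lambda>j. c * t j) = (\<lambda>j. c * trunc n t j)" for t :: "nat \<Rightarrow> real" and c
    by (auto simp: trunc_def)
  ultimately show ?thesis
    using homog_funsD(3)[OF h] by (auto simp: homog_funs_def o_def)
qed

section \<open>The l1 norm as order unit, and density of sublattices\<close>

text \<open>This norm is built from the coordinates by lattice operations, so it can be inserted
  into the calculus and serves as the unit in which approximation errors are measured.\<close>

definition l1 :: "nat \<Rightarrow> (nat \<Rightarrow> real) \<Rightarrow> real" where
  "l1 n t = (\<Sum>j<n. \<bar>t j\<bar>)"

text \<open>Fixing the entries from \<open>n\<close> on at zero gives a copy of the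
  finite-dimensional sphere inside the space of sequences.\<close>

definition l1_sphere :: "nat \<Rightarrow> (nat \<Rightarrow> real) set" where
  "l1_sphere n = {t. (\<forall>j\<ge>n. t j = 0) \<and> l1 n t = 1}"

lemma l1_nonneg: "0 \<le> l1 n t"
  by (simp add: l1_def sum_nonneg)

lemma continuous_on_l1: "continuous_on UNIV (l1 n)"
  unfolding l1_def by (intro continuous_intros continuous_on_product_coordinates)

text \<open>A closed subset of a product of intervals \<open>{-1..1}\<close>, which is compact by
  Tychonoff's theorem.\<close>

lemma compact_l1_sphere: "compact (l1_sphere n)"
proof -
  have "compactin (product_topology (\<lambda>i. euclidean) UNIV) (PiE UNIV (\<lambda>_::nat. {-1..1::real}))"
    by (subst compactin_PiE) auto
  then have c: "compact (PiE UNIV (\<lambda>_::nat. {-1..1::real}))"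
    unfolding euclidean_product_topology compactin_euclidean_iff .
  have "closed {t::nat \<Rightarrow> real. \<forall>j. j \<ge> n \<longrightarrow> t j = 0}"
    by (intro closed_Collect_all closed_Collect_imp closed_Collect_eq continuous_intros) auto
  moreover have "closed {t. l1 n t = 1}"
    by (intro closed_Collect_eq continuous_on_l1 continuous_intros)
  ultimately have cl: "closed (l1_sphere n)"
    unfolding l1_sphere_def by (simp add: closed_Collect_conj)
  have "l1_sphere n \<subseteq> PiE UNIV (\<lambda>_::nat. {-1..1::real})"
  proof
    fix t assume t: "t \<in> l1_sphere n"
    have "\<bar>t j\<bar> \<le> 1" for j
    proof (cases "j < n")
      case True
      then have "\<bar>t j\<bar> \<le> l1 n t" unfolding l1_def by (intro member_le_sum) auto
      then show ?thesis using t by (simp add: l1_sphere_def)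
    next
      case False
      then show ?thesis using t by (simp add: l1_sphere_def)
    qed
    then have "t j \<in> {-1..1}" for j by (simp add: abs_le_iff minus_le_iff)
    then show "t \<in> PiE UNIV (\<lambda>_::nat. {-1..1::real})" by auto
  qed
  then have "l1_sphere n = PiE UNIV (\<lambda>_::nat. {-1..1::real}) \<inter> l1_sphere n" by blast
  then show ?thesis using compact_Int_closed[OF c cl] by simp
qed

text \<open>Each \<open>\<bar>t k\<bar>\<close> is the maximum of \<open>t k\<close> and
  \<open>-1 * t k\<close>. The set \<open>L\<close> is left abstract because the lemma serves for
  all homogeneous functions, for the domain of \<open>calc_graph\<close> and for the agreement set
  of two calculi.\<close>

lemma l1_mem_sublattice:
  assumes "(\<lambda>t. 0) \<in> L"
    and "\<And>f g. f \<in> L \<Longrightarrow> g \<in> L \<Longrightarrow> (\<lambda>t. f t + g t) \<in> L"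
    and "\<And>f c. f \<in> L \<Longrightarrow> (\<lambda>t. c * f t) \<in> L"
    and "\<And>f g. f \<in> L \<Longrightarrow> g \<in> L \<Longrightarrow> (\<lambda>t. max (f t) (g t)) \<in> L"
    and "\<And>j. j < n \<Longrightarrow> (\<lambda>t. t j) \<in> L"
  shows "l1 n \<in> L"
proof -
  have "(\<lambda>t. \<Sum>j<k. \<bar>t j\<bar>) \<in> L" if "k \<le> n" for k
    using that
  proof (induction k)
    case 0
    then show ?case using assms(1) by simp
  next
    case (Suc k)
    have k: "(\<lambda>t. t k) \<in> L" using assms(5) Suc by simp
    have "(\<lambda>t. max (t k) (-1 * t k)) \<in> L" by (intro assms(4) assms(3) k)
    moreover have "(\<lambda>t. max (t k) (-1 * t k)) = (\<lambda>t::nat\<Rightarrow>real. \<bar>t k\<bar>)"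
      by (auto simp: max_def)
    ultimately show ?case using assms(2) Suc by simp
  qed
  then show ?thesis unfolding l1_def[abs_def] by blast
qed

lemma l1_mem_homog_funs: "l1 n \<in> homog_funs n"
  by (intro l1_mem_sublattice homog_funs_zero homog_funs_add homog_funs_scale homog_funs_max
      homog_funs_proj)

text \<open>The lattice approximation theorem gives error \<open>e\<close> on the compact sphere;
  positive homogeneity spreads it over all rays as \<open>e * l1 n t\<close>.\<close>

lemma homog_funs_dense:
  assumes LH: "L \<subseteq> homog_funs n"
    and zero: "(\<lambda>t. 0) \<in> L"
    and add: "\<And>f g. f \<in> L \<Longrightarrow> g \<in> L \<Longrightarrow> (\<lambda>t. f t + g t) \<in> L"
    and scale: "\<And>f c. f \<in> L \<Longrightarrow> (\<lambda>t. c * f t) \<in> L"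
    and max: "\<And>f g. f \<in> L \<Longrightarrow> g \<in> L \<Longrightarrow> (\<lambda>t. max (f t) (g t)) \<in> L"
    and proj: "\<And>j. j < n \<Longrightarrow> (\<lambda>t. t j) \<in> L"
    and h: "h \<in> homog_funs n" and e: "e > 0"
  shows "\<exists>f\<in>L. \<forall>t. \<bar>h t - f t\<bar> \<le> e * l1 n t"
proof -
  have l1: "l1 n \<in> L" by (rule l1_mem_sublattice) (intro zero add scale max proj; assumption)+
  have min: "(\<lambda>t. min (f t) (g t)) \<in> L" if "f \<in> L" "g \<in> L" for f g
  proof -
    have "(\<lambda>t. -1 * max (-1 * f t) (-1 * g t)) \<in> L"
      by (intro scale max that)
    moreover have "(\<lambda>t. -1 * max (-1 * f t) (-1 * g t)) = (\<lambda>t. min (f t) (g t))"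
      by (auto simp: max_def min_def)
    ultimately show ?thesis by simp
  qed
  text \<open>On the sphere \<^term>\<open>l1 n\<close> is the constant 1, so together with one coordinate it
    interpolates any two values.\<close>
  have ip: "\<exists>f\<in>L. f s = h s \<and> f t = h t" if s: "s \<in> l1_sphere n" and t: "t \<in> l1_sphere n" for s t
  proof (cases "s = t")
    case True
    show ?thesis
      by (rule bexI[OF _ scale[OF l1, where c = "h s"]]) (use True s in \<open>auto simp: l1_sphere_def\<close>)
  next
    case False
    then obtain j where j: "s j \<noteq> t j" by auto
    then have "j < n" using s t by (auto simp: l1_sphere_def) (metis leI)
    define b where "b = (h s - h t) / (s j - t j)"
    have b: "b * (s j - t j) = h s - h t" using j by (simp add: b_def)
    have "(\<lambda>r. (h s - b * s j) * l1 n r + b * r j) \<in> L"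
      by (intro add scale l1 proj \<open>j < n\<close>)
    then show ?thesis
      by (rule bexI[rotated]) (use s t b in \<open>auto simp: l1_sphere_def algebra_simps\<close>)
  qed
  have "\<exists>f\<in>L. \<forall>t\<in>l1_sphere n. \<bar>h t - f t\<bar> < e"
  proof (rule lattice_stone_weierstrass)
    show "continuous_on UNIV f" if "f \<in> L" for f
      using that LH homog_funsD(1) by blast
  qed (use compact_l1_sphere max min ip zero homog_funsD(1)[OF h] e in auto)
  then obtain f where f: "f \<in> L" and fh: "\<And>t. t \<in> l1_sphere n \<Longrightarrow> \<bar>h t - f t\<bar> < e"
    by blast
  have fH: "f \<in> homog_funs n" using f LH by auto
  have "\<bar>h t - f t\<bar> \<le> e * l1 n t" for t
  proof (cases "l1 n t = 0")
    \<comment> \<open>Here the truncation of \<open>t\<close> is zero, and homogeneity with factor 0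
      makes both functions vanish there.\<close>
    case True
    then have "\<And>j. j < n \<Longrightarrow> t j = 0" by (auto simp: l1_def sum_nonneg_eq_0_iff)
    then have "trunc n t = (\<lambda>j. 0 * t j)" by (auto simp: trunc_def)
    then have "h t = 0" "f t = 0"
      using homog_funsD(2)[OF h, of t] homog_funsD(3)[OF h, of 0 t]
        homog_funsD(2)[OF fH, of t] homog_funsD(3)[OF fH, of 0 t] by auto
    then show ?thesis using True by simp
  next
    case False
    define c where "c = l1 n t"
    have c: "c > 0" using False l1_nonneg[of n t] by (simp add: c_def)
    \<comment> \<open>The truncation is normalised rather than \<open>t\<close> itself, since points
      of the sphere vanish from index \<open>n\<close> on; \<open>h\<close> and \<open>f\<close> do
      not see the difference.\<close>
    define s where "s = (\<lambda>j. inverse c * trunc n t j)"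
    have "l1 n s = inverse c * l1 n t"
      using c by (auto simp: l1_def s_def trunc_def abs_mult sum_distrib_left)
    then have "s \<in> l1_sphere n"
      using c by (auto simp: l1_sphere_def c_def[symmetric]) (auto simp: s_def trunc_def)
    then have "\<bar>h s - f s\<bar> < e" by (rule fh)
    moreover have "h s = inverse c * h t" "f s = inverse c * f t"
      unfolding s_def using c homog_funsD[OF h] homog_funsD[OF fH] by auto
    ultimately have "\<bar>inverse c * (h t - f t)\<bar> < e" by (simp add: algebra_simps)
    then have "\<bar>h t - f t\<bar> < e * c" using c by (simp add: abs_mult field_simps)
    then show ?thesis by (simp add: c_def)
  qed
  then show ?thesis using f by blast
qed

section \<open>Norm estimates in Banach lattices\<close>

lemma sup_minus_nonneg:
  fixes x :: "'x::banach_lattice"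
  shows "0 \<le> sup x (- x)"
proof -
  have "x + (- x) \<le> sup x (- x) + sup x (- x)" by (intro add_mono) auto
  then have "0 \<le> 2 *\<^sub>R sup x (- x)" by (simp add: scaleR_2)
  then have "(1/2) *\<^sub>R 0 \<le> (1/2) *\<^sub>R (2 *\<^sub>R sup x (- x))"
    by (intro scaleR_left_mono) auto
  then show ?thesis by simp
qed

text \<open>The hypotheses put the modulus of \<open>z\<close> below \<open>w\<close>, hence below
  the modulus of \<open>w\<close>.\<close>

lemma norm_le_of_bounds:
  fixes z w :: "'x::banach_lattice"
  assumes "z \<le> w" "- z \<le> w"
  shows "norm z \<le> norm w"
  by (rule norm_mono_modulus) (use assms in \<open>meson le_sup_iff sup_ge1 order_trans\<close>)

lemma norm_sup_minus: "norm (sup x (- x)) = norm (x :: 'x::banach_lattice)"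
proof (rule antisym)
  have "sup x (- x) \<le> sup x (- x)" "- sup x (- x) \<le> sup x (- x)"
    using sup_minus_nonneg[of x] by (auto intro: order_trans[of _ 0])
  then show "norm (sup x (- x)) \<le> norm x"
    by (intro norm_mono_modulus) auto
qed (rule norm_le_of_bounds, auto)

text \<open>\<open>sup a b\<close> exceeds \<open>sup c d\<close> by at most the sum of the moduli
  of \<open>a - c\<close> and \<open>b - d\<close>, and conversely. This continuity of
  \<open>sup\<close> lets the calculus keep suprema in the limit.\<close>

lemma norm_sup_diff_le:
  fixes a b c d :: "'x::banach_lattice"
  shows "norm (sup a b - sup c d) \<le> norm (a - c) + norm (b - d)"
proof -
  define p where "p = sup (a - c) (- (a - c))"
  define q where "q = sup (b - d) (- (b - d))"
  have p: "0 \<le> p" "a - c \<le> p" "c - a \<le> p" and q: "0 \<le> q" "b - d \<le> q" "d - b \<le> q"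
    unfolding p_def q_def
    using sup_minus_nonneg[of "a - c"] sup_ge1[of "a - c" "- (a - c)"] sup_ge2[of "- (a - c)" "a - c"]
      sup_minus_nonneg[of "b - d"] sup_ge1[of "b - d" "- (b - d)"] sup_ge2[of "- (b - d)" "b - d"]
    by simp_all
  have pq: "p \<le> p + q" "q \<le> p + q" using p q by auto
  have "a \<le> sup c d + (p + q)" "b \<le> sup c d + (p + q)"
    using add_mono[OF sup_ge1[of c d] order_trans[OF p(2) pq(1)]]
      add_mono[OF sup_ge2[of d c] order_trans[OF q(2) pq(2)]] by auto
  then have 1: "sup a b - sup c d \<le> p + q" by (simp add: algebra_simps)
  have "c \<le> sup a b + (p + q)" "d \<le> sup a b + (p + q)"
    using add_mono[OF sup_ge1[of a b] order_trans[OF p(3) pq(1)]]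
      add_mono[OF sup_ge2[of b a] order_trans[OF q(3) pq(2)]] by auto
  then have 2: "- (sup a b - sup c d) \<le> p + q" by (simp add: algebra_simps)
  have "norm (sup a b - sup c d) \<le> norm (p + q)" by (rule norm_le_of_bounds[OF 1 2])
  also have "\<dots> \<le> norm p + norm q" by (rule norm_triangle_ineq)
  finally show ?thesis unfolding p_def q_def norm_sup_minus .
qed

section \<open>Linear forms and elimination of variables\<close>

definition lin_comb :: "nat \<Rightarrow> (nat \<Rightarrow> 'a::real_vector) \<Rightarrow> (nat \<Rightarrow> real) \<Rightarrow> 'a" where
  "lin_comb n x a = (\<Sum>j<n. a j *\<^sub>R x j)"

lemma lin_comb_add: "lin_comb n x (\<lambda>j. a j + b j) = lin_comb n x a + lin_comb n x b"
  by (simp add: lin_comb_def scaleR_add_left sum.distrib)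

lemma lin_comb_diff: "lin_comb n x (\<lambda>j. a j - b j) = lin_comb n x a - lin_comb n x b"
  by (simp add: lin_comb_def scaleR_diff_left sum_subtractf)

lemma lin_comb_scale: "lin_comb n x (\<lambda>j. c * a j) = c *\<^sub>R lin_comb n x a"
  by (simp add: lin_comb_def scaleR_sum_right)

text \<open>Supplies the value of the eliminated variable between finitely many lower and upper
  bounds, either family of which may be empty.\<close>

lemma ex_strictly_between_finite:
  fixes P Q :: "real set"
  assumes "finite P" "finite Q" "\<And>p q. p \<in> P \<Longrightarrow> q \<in> Q \<Longrightarrow> p < q"
  shows "\<exists>s. (\<forall>p\<in>P. p < s) \<and> (\<forall>q\<in>Q. s < q)"
proof (cases "P = {} \<or> Q = {}")
  case True
  have "\<exists>s. \<forall>p\<in>P. p < s"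
    using assms(1) by (metis Max_ge gt_ex le_less_trans)
  moreover have "\<exists>s. \<forall>q\<in>Q. s < q"
    using assms(2) by (metis Min_le lt_ex less_le_trans)
  ultimately show ?thesis using True by auto
next
  case False
  then have "Max P < Min Q" using assms by simp
  then obtain s where "Max P < s" "s < Min Q" using dense by blast
  then show ?thesis using False assms by auto
qed

text \<open>
  The point is that a finite family of linear forms whose maximum is nonnegative has 0 in its
  convex hull.  Fourier--Motzkin elimination of the last variable gives this without separation
  theorems, which the library has only for type-indexed dimensions.
\<close>
lemma nonneg_of_max_nonneg:
  fixes x :: "nat \<Rightarrow> 'a::ordered_real_vector"
  assumes "finite B" and "\<And>t :: nat \<Rightarrow> real. \<exists>b\<in>B. 0 \<le> lin_comb n t b"
    and "\<And>b. b \<in> B \<Longrightarrow> lin_comb n x b \<le> y"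
  shows "0 \<le> y"
  using assms
proof (induction n arbitrary: B)
  \<comment> \<open>All forms are 0 here, and the second hypothesis makes \<open>B\<close> nonempty,
    so the third gives \<open>0 \<le> y\<close>.\<close>
  case 0
  then show ?case by (auto simp: lin_comb_def)
next
  case (Suc n)
  \<comment> \<open>For \<open>b n > 0 > b' n\<close> this is the convex combination of
    \<open>b\<close> and \<open>b'\<close> in which the coefficient of variable \<open>n\<close>
    cancels.\<close>
  define comb :: "(nat \<Rightarrow> real) \<Rightarrow> (nat \<Rightarrow> real) \<Rightarrow> nat \<Rightarrow> real" where
    "comb b b' = (\<lambda>j. (- b' n) / (b n - b' n) * b j + b n / (b n - b' n) * b' j)" for b b'
  define Z where "Z = {b\<in>B. b n = 0}"
  define U where "U = {b\<in>B. b n > 0}"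
  define D where "D = {b\<in>B. b n < 0}"
  define B1 where "B1 = Z \<union> (\<lambda>(b, b'). comb b b') ` (U \<times> D)"
  have fin: "finite Z" "finite U" "finite D"
    using Suc.prems(1) by (auto simp: Z_def U_def D_def)
  have lc: "lin_comb m z (comb b b') =
      ((- b' n) / (b n - b' n)) *\<^sub>R lin_comb m z b + (b n / (b n - b' n)) *\<^sub>R lin_comb m z b'"
    for m b b' and z :: "nat \<Rightarrow> 'b::real_vector"
    unfolding comb_def by (subst lin_comb_add, subst lin_comb_scale, subst lin_comb_scale) simp
  show ?case
  proof (rule Suc.IH)
    show "finite B1" using fin by (auto simp: B1_def)
  next
    fix t :: "nat \<Rightarrow> real"
    show "\<exists>b\<in>B1. 0 \<le> lin_comb n t b"
    proof (rule ccontr)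
      assume "\<not> ?thesis"
      then have neg: "\<And>b. b \<in> B1 \<Longrightarrow> lin_comb n t b < 0" by force
      \<comment> \<open>An \<open>s\<close> strictly between these bounds makes every form of
        \<open>U\<close> and \<open>D\<close> negative at \<open>t(n := s)\<close>; the bounds are
        compatible because each combined form is negative at \<open>t\<close>.\<close>
      have "\<exists>s. (\<forall>p\<in>(\<lambda>b. lin_comb n t b / - b n) ` D. p < s) \<and>
          (\<forall>q\<in>(\<lambda>b. - lin_comb n t b / b n) ` U. s < q)"
      proof (rule ex_strictly_between_finite)
        fix p q
        assume "p \<in> (\<lambda>b. lin_comb n t b / - b n) ` D" "q \<in> (\<lambda>b. - lin_comb n t b / b n) ` U"
        then obtain b b' where b: "b \<in> U" "b' \<in> D"
          "p = lin_comb n t b' / - b' n" "q = - lin_comb n t b / b n" by auto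
        then have pos: "b n > 0" "b' n < 0" by (auto simp: U_def D_def)
        have "lin_comb n t (comb b b') < 0" using b by (intro neg) (auto simp: B1_def)
        then have "((- b' n) * lin_comb n t b + b n * lin_comb n t b') / (b n - b' n) < 0"
          by (simp add: lc add_divide_distrib diff_divide_distrib)
        then have "(- b' n) * lin_comb n t b + b n * lin_comb n t b' < 0"
          using pos by (simp add: divide_less_0_iff)
        then show "p < q" unfolding b using pos by (simp add: field_simps)
      qed (use fin in auto)
      then obtain s where s: "\<And>b. b \<in> D \<Longrightarrow> lin_comb n t b / - b n < s"
        "\<And>b. b \<in> U \<Longrightarrow> s < - lin_comb n t b / b n" by auto
      have eq: "lin_comb (Suc n) (t(n := s)) b = lin_comb n t b + b n * s" for b
        by (simp add: lin_comb_def)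
      obtain b where b: "b \<in> B" "0 \<le> lin_comb n t b + b n * s"
        using Suc.prems(2)[of "t(n := s)"] unfolding eq by blast
      consider "b \<in> Z" | "b \<in> U" | "b \<in> D" using b(1) linorder_less_linear[of "b n" 0] by (auto simp: Z_def U_def D_def)
      then show False
      proof cases
        case 1
        then show ?thesis using b neg[of b] by (auto simp: B1_def Z_def)
      next
        case 2
        then show ?thesis using b s(2)[of b] by (simp add: U_def field_simps)
      next
        case 3
        then show ?thesis using b s(1)[of b] by (simp add: D_def field_simps)
      qed
    qed
  next
    fix c assume c: "c \<in> B1"
    have "c n = 0 \<and> lin_comb (Suc n) x c \<le> y"
    proof (cases "c \<in> Z")
      case True
      then show ?thesis using Suc.prems(3) by (auto simp: Z_def)
    next
      case False
      then obtain b b' where b: "b \<in> U" "b' \<in> D" "c = comb b b'" using c by (auto simp: B1_def)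
      then have pos: "b n > 0" "b' n < 0" "b \<in> B" "b' \<in> B" by (auto simp: U_def D_def)
      have "c n = 0" using pos by (simp add: b comb_def)
      have "lin_comb (Suc n) x c \<le> ((- b' n) / (b n - b' n)) *\<^sub>R y + (b n / (b n - b' n)) *\<^sub>R y"
        unfolding b lc using pos
        by (intro add_mono scaleR_left_mono Suc.prems(3)) (auto simp: divide_nonpos_pos)
      also have "\<dots> = ((- b' n) / (b n - b' n) + b n / (b n - b' n)) *\<^sub>R y"
        by (simp only: scaleR_add_left)
      also have "(- b' n) / (b n - b' n) + b n / (b n - b' n) = 1"
        using pos by (simp flip: diff_divide_distrib)
      finally show ?thesis using \<open>c n = 0\<close> by simp
    qed
    moreover have "lin_comb (Suc n) x c = lin_comb n x c + c n *\<^sub>R x n"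
      by (simp add: lin_comb_def)
    ultimately show "lin_comb n x c \<le> y" by auto
  qed
qed

section \<open>Finite suprema of linear forms in a vector lattice\<close>

text \<open>The type covers both the reals and \<open>'x\<close>, so one coefficient set
  \<open>A\<close> yields a piecewise linear function of real variables and its counterpart in the
  lattice.\<close>

definition sup_lin :: "nat \<Rightarrow> (nat \<Rightarrow> 'a::{ordered_real_vector,lattice}) \<Rightarrow> (nat \<Rightarrow> real) set \<Rightarrow> 'a" where
  "sup_lin n x A = Sup_fin (lin_comb n x ` A)"

definition set_add :: "(nat \<Rightarrow> real) set \<Rightarrow> (nat \<Rightarrow> real) set \<Rightarrow> (nat \<Rightarrow> real) set" where
  "set_add A B = (\<lambda>(a, b). (\<lambda>j. a j + b j)) ` (A \<times> B)"

lemma set_add_finite_nonempty: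
  "finite A \<Longrightarrow> finite B \<Longrightarrow> finite (set_add A B)"
  "A \<noteq> {} \<Longrightarrow> B \<noteq> {} \<Longrightarrow> set_add A B \<noteq> {}"
  by (auto simp: set_add_def)

lemma sup_lin_le_iff:
  "finite A \<Longrightarrow> A \<noteq> {} \<Longrightarrow> sup_lin n x A \<le> y \<longleftrightarrow> (\<forall>a\<in>A. lin_comb n x a \<le> y)"
  unfolding sup_lin_def by (subst Sup_fin.bounded_iff) auto

lemma sup_lin_upper: "finite A \<Longrightarrow> a \<in> A \<Longrightarrow> lin_comb n x a \<le> sup_lin n x A"
  unfolding sup_lin_def by (rule Sup_fin.coboundedI) auto

text \<open>Translations commute with suprema: bounding \<open>sup_lin n x A\<close> for each fixed
  \<open>b\<close> and then taking the supremum over \<open>b\<close> gives the harder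
  inequality.\<close>

lemma sup_lin_add:
  assumes "finite A" "finite B" "A \<noteq> {}" "B \<noteq> {}"
  shows "sup_lin n x (set_add A B) = sup_lin n x A + sup_lin n x B"
proof (rule antisym)
  show "sup_lin n x (set_add A B) \<le> sup_lin n x A + sup_lin n x B"
    by (subst sup_lin_le_iff)
      (auto simp: set_add_finite_nonempty assms set_add_def lin_comb_add intro!: add_mono sup_lin_upper)
  have "lin_comb n x a + lin_comb n x b \<le> sup_lin n x (set_add A B)" if "a \<in> A" "b \<in> B" for a b
    unfolding lin_comb_add[symmetric]
    by (rule sup_lin_upper) (use assms that in \<open>auto simp: set_add_finite_nonempty set_add_def\<close>)
  then have "sup_lin n x A \<le> sup_lin n x (set_add A B) - lin_comb n x b" if "b \<in> B" for b
    unfolding sup_lin_le_iff[OF assms(1,3)] using that by (simp add: le_diff_eq)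
  then have "sup_lin n x B \<le> sup_lin n x (set_add A B) - sup_lin n x A"
    unfolding sup_lin_le_iff[OF assms(2,4)] by (simp add: le_diff_eq add.commute)
  then show "sup_lin n x A + sup_lin n x B \<le> sup_lin n x (set_add A B)"
    by (simp add: le_diff_eq add.commute)
qed

lemma sup_lin_Un:
  assumes "finite A" "finite B" "A \<noteq> {}" "B \<noteq> {}"
  shows "sup_lin n x (A \<union> B) = sup (sup_lin n x A) (sup_lin n x B)"
  unfolding sup_lin_def image_Un by (rule Sup_fin.union) (use assms in auto)

lemma sup_lin_scale:
  assumes "finite A" "A \<noteq> {}" "0 \<le> c"
  shows "sup_lin n x ((\<lambda>a j. c * a j) ` A) = c *\<^sub>R sup_lin n x A"
proof (cases "c = 0")
  case True
  have "(\<lambda>a j. c * a j) ` A = {\<lambda>j. 0}"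
    using True assms by auto
  then show ?thesis using True by (simp add: sup_lin_def lin_comb_def)
next
  case False
  then have c: "c > 0" using assms by simp
  show ?thesis
  proof (rule antisym)
    show "sup_lin n x ((\<lambda>a j. c * a j) ` A) \<le> c *\<^sub>R sup_lin n x A"
      by (subst sup_lin_le_iff)
        (use assms in \<open>auto simp: lin_comb_scale intro!: scaleR_left_mono sup_lin_upper\<close>)
    have "sup_lin n x A \<le> inverse c *\<^sub>R sup_lin n x ((\<lambda>a j. c * a j) ` A)"
    proof (subst sup_lin_le_iff[OF assms(1,2)], rule ballI)
      fix a assume "a \<in> A"
      then have "lin_comb n x (\<lambda>j. c * a j) \<le> sup_lin n x ((\<lambda>a j. c * a j) ` A)"
        by (intro sup_lin_upper) (use assms in auto)
      then have "inverse c *\<^sub>R lin_comb n x (\<lambda>j. c * a j) \<le> inverse c *\<^sub>R sup_lin n x ((\<lambda>a j. c * a j) ` A)"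
        by (intro scaleR_left_mono) (use c in auto)
      then show "lin_comb n x a \<le> inverse c *\<^sub>R sup_lin n x ((\<lambda>a j. c * a j) ` A)"
        using c by (simp add: lin_comb_scale)
    qed
    then have "c *\<^sub>R sup_lin n x A \<le> c *\<^sub>R inverse c *\<^sub>R sup_lin n x ((\<lambda>a j. c * a j) ` A)"
      by (intro scaleR_left_mono) (use c in auto)
    then show "c *\<^sub>R sup_lin n x A \<le> sup_lin n x ((\<lambda>a j. c * a j) ` A)"
      using c by simp
  qed
qed

text \<open>This carries inequalities from the reals to a vector lattice. For each \<open>b\<close>
  in \<open>B\<close>, some form \<open>a - b\<close> is nonnegative at each real \<open>t\<close>,
  since the maximum over \<open>A\<close> is attained; elimination then bounds
  \<open>lin_comb n x b\<close>.\<close>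

lemma sup_lin_mono:
  fixes x :: "nat \<Rightarrow> 'a::{ordered_real_vector,lattice}"
  assumes fin: "finite A" "finite B" "A \<noteq> {}" "B \<noteq> {}"
    and le: "\<And>t :: nat \<Rightarrow> real. sup_lin n t B \<le> sup_lin n t A"
  shows "sup_lin n x B \<le> sup_lin n x A"
proof (subst sup_lin_le_iff[OF fin(2,4)], rule ballI)
  fix b assume b: "b \<in> B"
  have "0 \<le> sup_lin n x A - lin_comb n x b"
  proof (rule nonneg_of_max_nonneg)
    show "finite ((\<lambda>a j. a j - b j) ` A)" using fin by auto
  next
    fix t :: "nat \<Rightarrow> real"
    have "lin_comb n t b \<le> sup_lin n t A"
      using le[of t] sup_lin_upper[OF fin(2) b] order_trans by blast
    moreover have "sup_lin n t A \<in> lin_comb n t ` A"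
      unfolding sup_lin_def Sup_fin_Max by (rule Max_in) (use fin in auto)
    ultimately show "\<exists>c\<in>(\<lambda>a j. a j - b j) ` A. 0 \<le> lin_comb n t c"
      by (auto simp: lin_comb_diff)
  next
    fix c assume "c \<in> (\<lambda>a j. a j - b j) ` A"
    then show "lin_comb n x c \<le> sup_lin n x A - lin_comb n x b"
      by (auto simp: lin_comb_diff intro: sup_lin_upper[OF fin(1)])
  qed
  then show "lin_comb n x b \<le> sup_lin n x A" by simp
qed

section \<open>The calculus on the lattice generated by the coordinates\<close>

text \<open>The vector sublattice of \<open>homog_funs n \<times> 'x\<close> generated by the pairs (coordinate \<open>j\<close>, \<open>x j\<close>).\<close>
inductive calc_graph :: "nat \<Rightarrow> (nat \<Rightarrow> 'x::banach_lattice) \<Rightarrow> ((nat \<Rightarrow> real) \<Rightarrow> real) \<Rightarrow> 'x \<Rightarrow> bool"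
  for n x where
  zero: "calc_graph n x (\<lambda>t. 0) 0"
| proj: "j < n \<Longrightarrow> calc_graph n x (\<lambda>t. t j) (x j)"
| add: "calc_graph n x f y \<Longrightarrow> calc_graph n x g z \<Longrightarrow> calc_graph n x (\<lambda>t. f t + g t) (y + z)"
| scale: "calc_graph n x f y \<Longrightarrow> calc_graph n x (\<lambda>t. c * f t) (c *\<^sub>R y)"
| sup: "calc_graph n x f y \<Longrightarrow> calc_graph n x g z \<Longrightarrow>
    calc_graph n x (\<lambda>t. max (f t) (g t)) (sup y z)"

lemma calc_graph_homog: "calc_graph n x f y \<Longrightarrow> f \<in> homog_funs n"
  by (induction rule: calc_graph.induct)
    (auto intro: homog_funs_zero homog_funs_add homog_funs_scale homog_funs_max homog_funs_proj)

text \<open>Adding \<open>b + d\<close> to both arguments clears the subtracted terms; this keeps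
  differences of suprema closed under \<open>sup\<close>.\<close>

lemma sup_diff_diff:
  fixes a b c d :: "'a::{ordered_ab_group_add,lattice}"
  shows "sup (a - b) (c - d) = sup (a + d) (c + b) - (b + d)"
proof (rule antisym)
  have "a + d \<le> sup (a + d) (c + b)" "c + b \<le> sup (a + d) (c + b)" by (rule sup_ge1 sup_ge2)+
  then have "a - b + (b + d) \<le> sup (a + d) (c + b)" "c - d + (b + d) \<le> sup (a + d) (c + b)"
    by (simp_all add: add.commute)
  then show "sup (a - b) (c - d) \<le> sup (a + d) (c + b) - (b + d)"
    by (intro sup_least) (simp_all only: le_diff_eq)
  have "a - b + (b + d) \<le> sup (a - b) (c - d) + (b + d)"
    "c - d + (b + d) \<le> sup (a - b) (c - d) + (b + d)"
    by (intro add_right_mono sup_ge1 sup_ge2)+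
  moreover have "a - b + (b + d) = a + d" "c - d + (b + d) = c + b" by simp_all
  ultimately have "a + d \<le> sup (a - b) (c - d) + (b + d)" "c + b \<le> sup (a - b) (c - d) + (b + d)"
    by simp_all
  then show "sup (a + d) (c + b) - (b + d) \<le> sup (a - b) (c - d)"
    unfolding diff_le_eq by (rule sup_least)
qed

text \<open>Differences of finite suprema of linear forms are closed under every rule of the
  induction, with the same sets \<open>A\<close> and \<open>B\<close> for the function and for its
  value in \<open>'x\<close>.\<close>

lemma calc_graph_normal_form:
  assumes "calc_graph n x f y"
  shows "\<exists>A B. finite A \<and> finite B \<and> A \<noteq> {} \<and> B \<noteq> {} \<and>
    (\<forall>t. f t = sup_lin n t A - sup_lin n t B) \<and> y = sup_lin n x A - sup_lin n x B"
  using assms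
proof (induction rule: calc_graph.induct)
  case zero
  then show ?case by (intro exI[of _ "{\<lambda>j. 0}"]) auto
next
  case (proj j)
  have *: "lin_comb n z (\<lambda>i. if i = j then 1 else 0) = z j" for z :: "nat \<Rightarrow> 'b::real_vector"
    using proj by (simp add: lin_comb_def if_distrib[of "\<lambda>r. r *\<^sub>R _"] sum.delta cong: if_cong)
  show ?case
    by (intro exI[of _ "{\<lambda>i. if i = j then 1 else 0}"] exI[of _ "{\<lambda>i. 0}"])
      (simp add: sup_lin_def *, simp add: lin_comb_def)
next
  case (add f y g z)
  then obtain A B C D where AB: "finite A" "finite B" "A \<noteq> {}" "B \<noteq> {}"
      "\<And>t. f t = sup_lin n t A - sup_lin n t B" "y = sup_lin n x A - sup_lin n x B"
    and CD: "finite C" "finite D" "C \<noteq> {}" "D \<noteq> {}"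
      "\<And>t. g t = sup_lin n t C - sup_lin n t D" "z = sup_lin n x C - sup_lin n x D" by auto
  show ?case
    by (intro exI[of _ "set_add A C"] exI[of _ "set_add B D"])
      (simp add: AB CD set_add_finite_nonempty sup_lin_add)
next
  case (scale f y c)
  then obtain A B where AB: "finite A" "finite B" "A \<noteq> {}" "B \<noteq> {}"
      "\<And>t. f t = sup_lin n t A - sup_lin n t B" "y = sup_lin n x A - sup_lin n x B" by auto
  show ?case
  proof (cases "0 \<le> c")
    case True
    then show ?thesis
      by (intro exI[of _ "(\<lambda>a j. c * a j) ` A"] exI[of _ "(\<lambda>a j. c * a j) ` B"])
        (simp add: AB sup_lin_scale algebra_simps)
  next
    case False
    \<comment> \<open>A negative factor exchanges minuend and subtrahend, so \<open>A\<close> and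
      \<open>B\<close> swap roles and \<open>- c\<close> scales both.\<close>
    have *: "sup_lin n z ((\<lambda>a j. - c * a j) ` S) = (- c) *\<^sub>R sup_lin n z S"
      if "finite S" "S \<noteq> {}" for S and z :: "nat \<Rightarrow> 'b::{ordered_real_vector,lattice}"
      by (rule sup_lin_scale) (use that False in auto)
    show ?thesis
      by (intro exI[of _ "(\<lambda>a j. - c * a j) ` B"] exI[of _ "(\<lambda>a j. - c * a j) ` A"])
        (simp add: AB *[simplified] algebra_simps)
  qed
next
  case (sup f y g z)
  then obtain A B C D where AB: "finite A" "finite B" "A \<noteq> {}" "B \<noteq> {}"
      "\<And>t. f t = sup_lin n t A - sup_lin n t B" "y = sup_lin n x A - sup_lin n x B"
    and CD: "finite C" "finite D" "C \<noteq> {}" "D \<noteq> {}"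
      "\<And>t. g t = sup_lin n t C - sup_lin n t D" "z = sup_lin n x C - sup_lin n x D" by auto
  \<comment> \<open>Over the common subtrahend from \<open>set_add B D\<close>, the maximum becomes
    a union of coefficient sets.\<close>
  show ?case
    by (intro exI[of _ "set_add A D \<union> set_add C B"] exI[of _ "set_add B D"])
      (simp add: AB CD set_add_finite_nonempty sup_lin_add sup_lin_Un sup_diff_diff
        sup_max[symmetric])
qed

text \<open>Positivity is \<open>sup_lin_mono\<close> read through the normal form. Applied to
  differences, it shows that a value depends only on the function and not on how it was
  generated.\<close>

lemma calc_graph_nonneg:
  assumes "calc_graph n x f y" "\<And>t. 0 \<le> f t"
  shows "0 \<le> y"
proof -
  obtain A B where AB: "finite A" "finite B" "A \<noteq> {}" "B \<noteq> {}"
      "\<And>t. f t = sup_lin n t A - sup_lin n t B" "y = sup_lin n x A - sup_lin n x B"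
    using calc_graph_normal_form[OF assms(1)] by auto
  have "sup_lin n x B \<le> sup_lin n x A"
    by (rule sup_lin_mono) (use AB assms(2) in \<open>auto simp: AB(5)\<close>)
  then show ?thesis using AB by simp
qed

lemma calc_graph_diff:
  assumes "calc_graph n x f y" "calc_graph n x g z"
  shows "calc_graph n x (\<lambda>t. f t - g t) (y - z)"
  using calc_graph.add[OF assms(1) calc_graph.scale[OF assms(2), of "-1"]] by simp

lemma calc_graph_l1: "\<exists>U. calc_graph n x (l1 n) U"
proof -
  have "l1 n \<in> {f. \<exists>y. calc_graph n x f y}"
    by (rule l1_mem_sublattice) (auto intro: calc_graph.intros)
  then show ?thesis by simp
qed

text \<open>Positivity applied to \<open>e * l1 n - (f - g)\<close> and its mirror image puts both
  \<open>y - z\<close> and \<open>z - y\<close> below \<open>e *\<^sub>R U\<close>, and the lattice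
  norm is monotone.\<close>

lemma calc_graph_norm_le:
  assumes f: "calc_graph n x f y" and g: "calc_graph n x g z" and U: "calc_graph n x (l1 n) U"
    and e: "0 \<le> e" and le: "\<And>t. \<bar>f t - g t\<bar> \<le> e * l1 n t"
  shows "norm (y - z) \<le> e * norm U"
proof -
  have "0 \<le> e *\<^sub>R U - (y - z)"
    by (rule calc_graph_nonneg[OF calc_graph_diff[OF calc_graph.scale[OF U] calc_graph_diff[OF f g]]])
      (use le in \<open>simp add: abs_le_iff\<close>)
  moreover have "0 \<le> e *\<^sub>R U - (z - y)"
    by (rule calc_graph_nonneg[OF calc_graph_diff[OF calc_graph.scale[OF U] calc_graph_diff[OF g f]]])
      (use le in \<open>simp add: abs_le_iff\<close>)
  ultimately have "norm (y - z) \<le> norm (e *\<^sub>R U)"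
    by (intro norm_le_of_bounds) auto
  then show ?thesis using e by simp
qed

section \<open>Extension by completeness and existence of the calculus\<close>

text \<open>The closure of \<open>calc_graph\<close> when functions are measured relative to
  \<open>l1 n\<close> and values by the norm. Being a relation, it can be stated before values are
  known to be unique.\<close>

definition calc_closure :: "nat \<Rightarrow> (nat \<Rightarrow> 'x::banach_lattice) \<Rightarrow> ((nat \<Rightarrow> real) \<Rightarrow> real) \<Rightarrow> 'x \<Rightarrow> bool" where
  "calc_closure n x h y \<longleftrightarrow>
    (\<forall>e>0. \<exists>f z. calc_graph n x f z \<and> (\<forall>t. \<bar>h t - f t\<bar> \<le> e * l1 n t) \<and> norm (y - z) \<le> e)"

lemma calc_closureE:
  assumes "calc_closure n x h y" "e > 0"
  obtains f z where "calc_graph n x f z" "\<And>t. \<bar>h t - f t\<bar> \<le> e * l1 n t" "norm (y - z) \<le> e"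
  using assms unfolding calc_closure_def by metis

lemma calc_graph_imp_closure: "calc_graph n x f y \<Longrightarrow> calc_closure n x f y"
  unfolding calc_closure_def by (auto intro!: exI[of _ f] exI[of _ y] simp: l1_nonneg)

text \<open>Two approximants to \<open>h\<close> are close relative to \<open>l1 n\<close>, so by
  \<open>calc_graph_norm_le\<close> their values are close in norm.\<close>

lemma calc_closure_unique:
  assumes "calc_closure n x h y" "calc_closure n x h y'"
  shows "y = y'"
proof -
  obtain U where U: "calc_graph n x (l1 n) U" using calc_graph_l1 by blast
  have bound: "norm (y - y') \<le> 0 + e" if e: "e > 0" for e
  proof -
    \<comment> \<open>The two value errors cost \<open>2 * d\<close> and the distance between the
      approximants costs \<open>2 * d * norm U\<close>, in total \<open>e\<close>.\<close>
    define d where "d = e / (2 + 2 * norm U)"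
    have pos: "2 + 2 * norm U > 0" using norm_ge_zero[of U] by linarith
    have d: "d > 0" "d * (2 + 2 * norm U) = e" using e pos by (auto simp: d_def)
    obtain f z where f: "calc_graph n x f z" "\<And>t. \<bar>h t - f t\<bar> \<le> d * l1 n t" "norm (y - z) \<le> d"
      using calc_closureE[OF assms(1) d(1)] by blast
    obtain g w where g: "calc_graph n x g w" "\<And>t. \<bar>h t - g t\<bar> \<le> d * l1 n t" "norm (y' - w) \<le> d"
      using calc_closureE[OF assms(2) d(1)] by blast
    have "norm (z - w) \<le> (2 * d) * norm U"
    proof (rule calc_graph_norm_le[OF f(1) g(1) U])
      show "\<bar>f t - g t\<bar> \<le> 2 * d * l1 n t" for t
        using f(2)[of t] g(2)[of t] by linarith
    qed (use d in simp)
    moreover have "norm (y - y') \<le> norm (y - z) + norm (z - w) + norm (y' - w)"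
      using norm_triangle_ineq4[of "(y - z) + (z - w)" "y' - w"]
        norm_triangle_ineq[of "y - z" "z - w"] by simp
    ultimately show ?thesis using f(3) g(3) d(2) by (simp add: algebra_simps)
  qed
  then have "norm (y - y') \<le> 0" by (rule field_le_epsilon)
  then show ?thesis by simp
qed

text \<open>Density gives approximants with errors \<open>1 / real (Suc k)\<close>;
  \<open>calc_graph_norm_le\<close> makes their values Cauchy, and the limit exists since
  \<open>'x\<close> is complete.\<close>

lemma calc_closure_exists:
  assumes h: "h \<in> homog_funs n"
  shows "\<exists>y. calc_closure n x h y"
proof -
  obtain U where U: "calc_graph n x (l1 n) U" using calc_graph_l1 by blast
  have approx: "\<exists>f z. calc_graph n x f z \<and> (\<forall>t. \<bar>h t - f t\<bar> \<le> e * l1 n t)" if "e > 0" for e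
    using homog_funs_dense[of "{f. \<exists>y. calc_graph n x f y}" n h e] h that
    by (auto intro: calc_graph.intros calc_graph_homog)
  have "\<forall>k. \<exists>f z. calc_graph n x f z \<and> (\<forall>t. \<bar>h t - f t\<bar> \<le> (1 / real (Suc k)) * l1 n t)"
  proof
    fix k
    show "\<exists>f z. calc_graph n x f z \<and> (\<forall>t. \<bar>h t - f t\<bar> \<le> (1 / real (Suc k)) * l1 n t)"
      by (rule approx) simp
  qed
  then obtain F Z where FZ: "\<And>k. calc_graph n x (F k) (Z k)"
    "\<And>k t. \<bar>h t - F k t\<bar> \<le> (1 / real (Suc k)) * l1 n t" by metis
  have dist: "norm (Z k - Z l) \<le> (1 / real (Suc k) + 1 / real (Suc l)) * norm U" for k l
  proof (rule calc_graph_norm_le[OF FZ(1) FZ(1) U])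
    show "\<bar>F k t - F l t\<bar> \<le> (1 / real (Suc k) + 1 / real (Suc l)) * l1 n t" for t
      using FZ(2)[of t k] FZ(2)[of t l] unfolding distrib_right by linarith
  qed simp
  have "Cauchy Z"
  proof (rule CauchyI)
    fix e :: real assume e: "e > 0"
    \<comment> \<open>Adding 1 avoids division by zero if \<open>U = 0\<close>.\<close>
    have pos: "2 * norm U + 1 > 0" using norm_ge_zero[of U] by linarith
    obtain N where N: "1 / real (Suc N) < e / (2 * norm U + 1)"
      using nat_approx_posE[of "e / (2 * norm U + 1)"] e pos by auto
    have "norm (Z k - Z l) < e" if "k \<ge> N" "l \<ge> N" for k l
    proof -
      have "1 / real (Suc k) + 1 / real (Suc l) \<le> 1 / real (Suc N) + 1 / real (Suc N)"
        using that by (intro add_mono divide_left_mono) auto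
      then have "(1 / real (Suc k) + 1 / real (Suc l)) * norm U \<le>
          (1 / real (Suc N) + 1 / real (Suc N)) * norm U"
        by (rule mult_right_mono) simp
      also have "\<dots> = 1 / real (Suc N) * (2 * norm U)" by (simp add: algebra_simps)
      also have "\<dots> \<le> 1 / real (Suc N) * (2 * norm U + 1)" by (intro mult_left_mono) auto
      also have "\<dots> < e" using N pos by (simp only: pos_less_divide_eq)
      finally show ?thesis using dist[of k l] by linarith
    qed
    then show "\<exists>M. \<forall>m\<ge>M. \<forall>n\<ge>M. norm (Z m - Z n) < e" by blast
  qed
  then obtain y where y: "Z \<longlonglongrightarrow> y" using Cauchy_convergent_iff convergent_def by blast
  have "calc_closure n x h y"
    unfolding calc_closure_def
  proof (intro allI impI)
    fix e :: real assume e: "e > 0"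
    obtain N where N: "1 / real (Suc N) < e" using nat_approx_posE[OF e] by auto
    obtain M where M: "\<And>k. k \<ge> M \<Longrightarrow> norm (Z k - y) < e" using LIMSEQ_D[OF y e] by blast
    \<comment> \<open>Index \<open>N\<close> controls the error of the function, \<open>M\<close>
      that of the value.\<close>
    define k where "k = max N M"
    have "1 / real (Suc k) \<le> 1 / real (Suc N)" by (intro divide_left_mono) (auto simp: k_def)
    then have "1 / real (Suc k) * l1 n t \<le> e * l1 n t" for t
      using N by (intro mult_right_mono l1_nonneg) linarith
    then have "\<bar>h t - F k t\<bar> \<le> e * l1 n t" for t using FZ(2)[of t k] order_trans by blast
    moreover have "norm (y - Z k) \<le> e" using M[of k] by (simp add: k_def norm_minus_commute)
    ultimately show "\<exists>f z. calc_graph n x f z \<and> (\<forall>t. \<bar>h t - f t\<bar> \<le> e * l1 n t) \<and> norm (y - z) \<le> e"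
      using FZ(1) by blast
  qed
  then show ?thesis by blast
qed

lemma calc_closure_add:
  assumes "calc_closure n x h y" "calc_closure n x h' y'"
  shows "calc_closure n x (\<lambda>t. h t + h' t) (y + y')"
  unfolding calc_closure_def
proof (intro allI impI)
  fix e :: real assume "e > 0"
  then have e: "e / 2 > 0" by simp
  obtain f z where f: "calc_graph n x f z" "\<And>t. \<bar>h t - f t\<bar> \<le> e / 2 * l1 n t" "norm (y - z) \<le> e / 2"
    using calc_closureE[OF assms(1) e] by blast
  obtain g w where g: "calc_graph n x g w" "\<And>t. \<bar>h' t - g t\<bar> \<le> e / 2 * l1 n t" "norm (y' - w) \<le> e / 2"
    using calc_closureE[OF assms(2) e] by blast
  have "\<bar>h t + h' t - (f t + g t)\<bar> \<le> e * l1 n t" for t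
    using f(2)[of t] g(2)[of t] by linarith
  moreover have "norm (y + y' - (z + w)) \<le> e"
    using norm_diff_triangle_ineq[of y y' z w] f(3) g(3) by linarith
  ultimately show "\<exists>f z. calc_graph n x f z \<and>
      (\<forall>t. \<bar>h t + h' t - f t\<bar> \<le> e * l1 n t) \<and> norm (y + y' - z) \<le> e"
    using calc_graph.add[OF f(1) g(1)] by blast
qed

text \<open>The maximum of reals and \<open>sup\<close> in \<open>'x\<close> both move by at most
  the sum of the changes in their arguments.\<close>

lemma calc_closure_sup:
  assumes "calc_closure n x h y" "calc_closure n x h' y'"
  shows "calc_closure n x (\<lambda>t. max (h t) (h' t)) (sup y y')"
  unfolding calc_closure_def
proof (intro allI impI)
  fix e :: real assume "e > 0"
  then have e: "e / 2 > 0" by simp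
  obtain f z where f: "calc_graph n x f z" "\<And>t. \<bar>h t - f t\<bar> \<le> e / 2 * l1 n t" "norm (y - z) \<le> e / 2"
    using calc_closureE[OF assms(1) e] by blast
  obtain g w where g: "calc_graph n x g w" "\<And>t. \<bar>h' t - g t\<bar> \<le> e / 2 * l1 n t" "norm (y' - w) \<le> e / 2"
    using calc_closureE[OF assms(2) e] by blast
  have "\<bar>max (h t) (h' t) - max (f t) (g t)\<bar> \<le> e * l1 n t" for t
    using f(2)[of t] g(2)[of t] by linarith
  moreover have "norm (sup y y' - sup z w) \<le> e"
    using norm_sup_diff_le[of y y' z w] f(3) g(3) by linarith
  ultimately show "\<exists>f z. calc_graph n x f z \<and>
      (\<forall>t. \<bar>max (h t) (h' t) - f t\<bar> \<le> e * l1 n t) \<and> norm (sup y y' - z) \<le> e"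
    using calc_graph.sup[OF f(1) g(1)] by blast
qed

lemma calc_closure_scale:
  assumes "calc_closure n x h y"
  shows "calc_closure n x (\<lambda>t. c * h t) (c *\<^sub>R y)"
  unfolding calc_closure_def
proof (intro allI impI)
  fix e :: real assume e: "e > 0"
  define d where "d = e / (\<bar>c\<bar> + 1)"
  have d: "d > 0" "\<bar>c\<bar> * d \<le> e" using e by (auto simp: d_def field_simps)
  obtain f z where f: "calc_graph n x f z" "\<And>t. \<bar>h t - f t\<bar> \<le> d * l1 n t" "norm (y - z) \<le> d"
    using calc_closureE[OF assms(1) d(1)] by blast
  have "\<bar>c * h t - c * f t\<bar> \<le> e * l1 n t" for t
  proof -
    have "\<bar>c * h t - c * f t\<bar> = \<bar>c\<bar> * \<bar>h t - f t\<bar>"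
      by (simp add: abs_mult[symmetric] right_diff_distrib)
    also have "\<dots> \<le> \<bar>c\<bar> * (d * l1 n t)" by (intro mult_left_mono f) simp
    also have "\<dots> = (\<bar>c\<bar> * d) * l1 n t" by simp
    also have "\<dots> \<le> e * l1 n t" by (intro mult_right_mono d l1_nonneg)
    finally show ?thesis .
  qed
  moreover have "norm (c *\<^sub>R y - c *\<^sub>R z) \<le> e"
  proof -
    have "norm (c *\<^sub>R y - c *\<^sub>R z) = \<bar>c\<bar> * norm (y - z)"
      by (simp flip: scaleR_diff_right)
    also have "\<dots> \<le> \<bar>c\<bar> * d" by (intro mult_left_mono f) simp
    finally show ?thesis using d by simp
  qed
  ultimately show "\<exists>f z. calc_graph n x f z \<and>
      (\<forall>t. \<bar>c * h t - f t\<bar> \<le> e * l1 n t) \<and> norm (c *\<^sub>R y - z) \<le> e"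
    using calc_graph.scale[OF f(1)] by blast
qed

text \<open>Unique existence in the closure makes the \<open>THE\<close> meaningful, and each law is
  a closure property of the relation.\<close>

lemma krivine_map_exists: "\<exists>\<tau>. is_krivine_map n x \<tau>"
proof -
  define \<tau> where "\<tau> = restrict (\<lambda>h. THE y. calc_closure n x h y) (homog_funs n)"
  have \<tau>: "\<tau> h = y" if "h \<in> homog_funs n" "calc_closure n x h y" for h y
    unfolding \<tau>_def using that calc_closure_unique[of n x h] by (auto intro!: the_equality)
  have cl: "calc_closure n x h (\<tau> h)" if h: "h \<in> homog_funs n" for h
    using calc_closure_exists[OF h, of x] \<tau>[OF h] by metis
  have "is_krivine_map n x \<tau>"
    unfolding is_krivine_map_def
    by (intro conjI ballI allI impI \<tau> homog_funs_add homog_funs_scale homog_funs_proj homog_funs_max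
        calc_closure_add calc_closure_scale calc_closure_sup cl calc_graph_imp_closure calc_graph.proj)
      (simp add: \<tau>_def)
  then show ?thesis by blast
qed

section \<open>Uniqueness of the calculus\<close>

lemma krivine_mapD:
  assumes "is_krivine_map n x \<tau>"
  shows "\<tau> \<in> extensional (homog_funs n)"
    "\<And>f g. f \<in> homog_funs n \<Longrightarrow> g \<in> homog_funs n \<Longrightarrow> \<tau> (\<lambda>t. f t + g t) = \<tau> f + \<tau> g"
    "\<And>f c. f \<in> homog_funs n \<Longrightarrow> \<tau> (\<lambda>t. c * f t) = c *\<^sub>R \<tau> f"
    "\<And>j. j < n \<Longrightarrow> \<tau> (\<lambda>t. t j) = x j"
    "\<And>f g. f \<in> homog_funs n \<Longrightarrow> g \<in> homog_funs n \<Longrightarrow> \<tau> (\<lambda>t. max (f t) (g t)) = sup (\<tau> f) (\<tau> g)"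
  using assms by (auto simp: is_krivine_map_def)

lemma krivine_map_zero: "is_krivine_map n x \<tau> \<Longrightarrow> \<tau> (\<lambda>t. 0) = 0"
  using krivine_mapD(3)[of n x \<tau> "\<lambda>t. 0" 0] homog_funs_zero by simp

lemma krivine_map_mono:
  assumes "is_krivine_map n x \<tau>" "f \<in> homog_funs n" "g \<in> homog_funs n" "\<And>t. f t \<le> g t"
  shows "\<tau> f \<le> \<tau> g"
proof -
  have "(\<lambda>t. max (f t) (g t)) = g" using assms(4) by (auto simp: max_def)
  then have "\<tau> g = sup (\<tau> f) (\<tau> g)" using krivine_mapD(5)[OF assms(1-3)] by simp
  then show ?thesis by (metis sup_ge1)
qed

text \<open>Continuity is automatic: preserving linear operations and maxima makes the map monotone,
  hence Lipschitz with respect to the unit \<open>l1 n\<close>.\<close>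

lemma krivine_map_norm_le:
  assumes k: "is_krivine_map n x \<tau>" and f: "f \<in> homog_funs n" and g: "g \<in> homog_funs n"
    and e: "0 \<le> e" and le: "\<And>t. \<bar>f t - g t\<bar> \<le> e * l1 n t"
  shows "norm (\<tau> f - \<tau> g) \<le> e * norm (\<tau> (l1 n))"
proof -
  note [simp] = homog_funs_add homog_funs_scale l1_mem_homog_funs f g
  have "\<tau> f \<le> \<tau> (\<lambda>t. g t + e * l1 n t)"
    by (rule krivine_map_mono[OF k]) (use le in \<open>auto simp: abs_le_iff algebra_simps\<close>)
  moreover have "\<tau> g \<le> \<tau> (\<lambda>t. f t + e * l1 n t)"
    by (rule krivine_map_mono[OF k]) (use le in \<open>auto simp: abs_le_iff algebra_simps\<close>)
  ultimately have "norm (\<tau> f - \<tau> g) \<le> norm (e *\<^sub>R \<tau> (l1 n))"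
    by (intro norm_le_of_bounds) (simp_all add: krivine_mapD(2,3)[OF k] algebra_simps)
  then show ?thesis using e by simp
qed

text \<open>The functions on which two calculi agree form a vector sublattice containing the
  coordinates, hence a dense one, and both maps are continuous.\<close>

lemma krivine_map_unique:
  assumes k1: "is_krivine_map n x \<sigma>" and k2: "is_krivine_map n x \<tau>"
  shows "\<sigma> = \<tau>"
proof (rule extensionalityI[OF krivine_mapD(1)[OF k1] krivine_mapD(1)[OF k2]])
  fix h assume h: "h \<in> homog_funs n"
  define L where "L = {f \<in> homog_funs n. \<sigma> f = \<tau> f}"
  have zero: "(\<lambda>t. 0) \<in> L"
    by (simp add: L_def krivine_map_zero[OF k1] krivine_map_zero[OF k2] homog_funs_zero)
  have add: "(\<lambda>t. f t + g t) \<in> L" if "f \<in> L" "g \<in> L" for f g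
    using that by (simp add: L_def krivine_mapD(2)[OF k1] krivine_mapD(2)[OF k2] homog_funs_add)
  have scale: "(\<lambda>t. c * f t) \<in> L" if "f \<in> L" for f c
    using that by (simp add: L_def krivine_mapD(3)[OF k1] krivine_mapD(3)[OF k2] homog_funs_scale)
  have max: "(\<lambda>t. max (f t) (g t)) \<in> L" if "f \<in> L" "g \<in> L" for f g
    using that by (simp add: L_def krivine_mapD(5)[OF k1] krivine_mapD(5)[OF k2] homog_funs_max)
  have proj: "(\<lambda>t. t j) \<in> L" if "j < n" for j
    using that by (simp add: L_def krivine_mapD(4)[OF k1] krivine_mapD(4)[OF k2] homog_funs_proj)
  define M where "M = norm (\<tau> (l1 n))"
  \<comment> \<open>\<open>l1 n\<close> lies in the agreement set, so one Lipschitz constant serves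
    both maps.\<close>
  have M: "norm (\<sigma> (l1 n)) = M"
  proof -
    have "l1 n \<in> L" by (rule l1_mem_sublattice) (intro zero add scale max proj; assumption)+
    then show ?thesis by (simp add: M_def L_def)
  qed
  have "norm (\<sigma> h - \<tau> h) \<le> 0 + e" if e: "e > 0" for e
  proof -
    define d where "d = e / (2 * M + 1)"
    have "M \<ge> 0" by (simp add: M_def)
    then have d: "d > 0" "d * (2 * M) \<le> e" using e by (auto simp: d_def field_simps)
    obtain f where f: "f \<in> L" "\<And>t. \<bar>h t - f t\<bar> \<le> d * l1 n t"
      using homog_funs_dense[OF _ zero add scale max proj h d(1)] by (auto simp: L_def)
    have fH: "f \<in> homog_funs n" "\<sigma> f = \<tau> f" using f by (auto simp: L_def)
    have "norm (\<sigma> h - \<sigma> f) \<le> d * M"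
      using krivine_map_norm_le[OF k1 h fH(1) _ f(2)] d by (simp add: M)
    moreover have "norm (\<tau> h - \<tau> f) \<le> d * M"
      using krivine_map_norm_le[OF k2 h fH(1) _ f(2)] d by (simp add: M_def)
    moreover have "\<sigma> h - \<tau> h = (\<sigma> h - \<sigma> f) - (\<tau> h - \<tau> f)" using fH by simp
    then have "norm (\<sigma> h - \<tau> h) \<le> norm (\<sigma> h - \<sigma> f) + norm (\<tau> h - \<tau> f)"
      using norm_triangle_ineq4 by metis
    ultimately show ?thesis using d by linarith
  qed
  then have "norm (\<sigma> h - \<tau> h) \<le> 0" by (rule field_le_epsilon)
  then show "\<sigma> h = \<tau> h" by simp
qed

lemma krivine_map_krivine: "is_krivine_map n x (krivine n x)"
  unfolding krivine_def
  by (rule theI'[where P = "is_krivine_map n x"]) (metis krivine_map_exists krivine_map_unique)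

lemma krivine_eqI: "is_krivine_map n x \<tau> \<Longrightarrow> krivine n x = \<tau>"
  using krivine_map_krivine krivine_map_unique by blast

section \<open>Changing the number of variables\<close>

text \<open>The restriction satisfies the defining conditions for \<open>m\<close> variables, so
  uniqueness identifies it.\<close>

lemma krivine_restrict:
  assumes "m \<le> n"
  shows "krivine m x = restrict (krivine n x) (homog_funs m)"
proof (rule krivine_eqI)
  note k = krivine_map_krivine[of n x]
  have H: "h \<in> homog_funs n" if "h \<in> homog_funs m" for h
    using homog_funs_mono[OF that assms] .
  show "is_krivine_map m x (restrict (krivine n x) (homog_funs m))"
    unfolding is_krivine_map_def using assms
    by (auto simp: homog_funs_add homog_funs_scale homog_funs_max homog_funs_proj H
        krivine_mapD(2-5)[OF k])
qed

text \<open>Composition with truncation preserves linear operations and maxima, and sends a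
  coordinate \<open>j \<ge> n\<close> to the zero function, whose value 0 is the entry
  \<open>x j\<close>. Uniqueness does the rest.\<close>

lemma krivine_comp_trunc:
  assumes x: "\<And>j. n \<le> j \<Longrightarrow> x j = 0" and "h \<in> homog_funs m"
  shows "krivine m x h = krivine n x (\<lambda>t. h (trunc n t))"
proof -
  note k = krivine_map_krivine[of n x]
  have "krivine m x = restrict (\<lambda>h. krivine n x (\<lambda>t. h (trunc n t))) (homog_funs m)"
  proof (rule krivine_eqI)
    have p: "krivine n x (\<lambda>t. trunc n t j) = x j" for j
      by (cases "j < n") (auto simp: trunc_def x krivine_mapD(4)[OF k] krivine_map_zero[OF k])
    show "is_krivine_map m x (restrict (\<lambda>h. krivine n x (\<lambda>t. h (trunc n t))) (homog_funs m))"
      unfolding is_krivine_map_def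
      by (auto simp: homog_funs_add homog_funs_scale homog_funs_max homog_funs_proj p
          krivine_mapD(2,3,5)[OF k] homog_funs_comp_trunc)
  qed
  then show ?thesis using assms(2) by simp
qed

lemma lattice_tuple_norm_cong:
  assumes "\<And>j. j < n \<Longrightarrow> x j = y j"
  shows "lattice_tuple_norm normY n x = lattice_tuple_norm normY n y"
proof -
  have "is_krivine_map n x = is_krivine_map n y"
    by (intro ext) (simp add: is_krivine_map_def assms)
  then show ?thesis by (simp add: lattice_tuple_norm_def krivine_def)
qed

lemma lattice_tuple_norm_nonneg: "0 \<le> lattice_tuple_norm normY n x"
  by (simp add: lattice_tuple_norm_def)

section \<open>The lattice norm of a tuple\<close>

context banach_sequence_lattice
begin

lemma zero_mem: "(\<lambda>j. 0) \<in> Y"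
  using scale_mem[OF unit_mem, of 0 0] by simp

lemma normY_zero: "normY (\<lambda>j. 0) = 0"
  using norm_eq_zero[OF zero_mem] by simp

lemma normY_nonneg: "f \<in> Y \<Longrightarrow> 0 \<le> normY f"
  using solid[of f "\<lambda>j. 0"] normY_zero by simp

lemma trunc_step: "trunc (Suc n) f = (\<lambda>j. trunc n f j + f n * (if j = n then 1 else 0 :: real))"
  by (auto simp: trunc_def fun_eq_iff less_Suc_eq)

lemma trunc_mem: "trunc n f \<in> Y"
proof (induction n)
  case 0
  then show ?case using zero_mem by (simp add: trunc_def)
next
  case (Suc n)
  then show ?case unfolding trunc_step by (intro add_mem scale_mem unit_mem)
qed

text \<open>The tuple is expanded in unit vectors; the resulting weighted l1 bound makes the norm
  continuous in the coordinates.\<close>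

lemma normY_trunc_le:
  "normY (trunc n f) \<le> (\<Sum>k<n. \<bar>f k\<bar> * normY (\<lambda>j. if j = k then 1 else 0))"
proof (induction n)
  case 0
  then show ?case using normY_zero by (simp add: trunc_def)
next
  case (Suc n)
  have "normY (trunc (Suc n) f) \<le>
      normY (trunc n f) + normY (\<lambda>j. f n * (if j = n then 1 else 0))"
    unfolding trunc_step by (intro norm_triangle trunc_mem scale_mem unit_mem)
  also have "normY (\<lambda>j. f n * (if j = n then 1 else 0)) = \<bar>f n\<bar> * normY (\<lambda>j. if j = n then 1 else 0)"
    by (rule norm_scale[OF unit_mem])
  finally show ?case using Suc by simp
qed

lemma normY_trunc_diff_le:
  "\<bar>normY (trunc n s) - normY (trunc n t)\<bar> \<le>
    (\<Sum>k<n. \<bar>s k - t k\<bar> * normY (\<lambda>j. if j = k then 1 else 0))"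
proof -
  have *: "normY (trunc n s) - normY (trunc n t) \<le>
      (\<Sum>k<n. \<bar>s k - t k\<bar> * normY (\<lambda>j. if j = k then 1 else 0))" for s t
  proof -
    have "trunc n s = (\<lambda>j. trunc n t j + trunc n (\<lambda>j. s j - t j) j)" by (auto simp: trunc_def)
    then have "normY (trunc n s) \<le> normY (trunc n t) + normY (trunc n (\<lambda>j. s j - t j))"
      using norm_triangle[OF trunc_mem trunc_mem] by metis
    then show ?thesis using normY_trunc_le[of n "\<lambda>j. s j - t j"] by linarith
  qed
  show ?thesis using *[of s t] *[of t s] by (simp add: abs_minus_commute abs_le_iff)
qed

text \<open>Makes the calculus applicable to the norm of \<open>Y\<close>. Continuity follows from
  the coordinatewise Lipschitz bound, which tends to 0 in the product topology.\<close>

lemma normY_trunc_homog: "(\<lambda>t. normY (trunc n t)) \<in> homog_funs n"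
proof -
  have "((\<lambda>t. normY (trunc n t)) \<longlongrightarrow> normY (trunc n s)) (at s)" for s
  proof -
    define g where "g t = (\<Sum>k<n. \<bar>t k - s k\<bar> * normY (\<lambda>j. if j = k then 1 else 0))" for t
    have "continuous_on UNIV g" unfolding g_def
      by (intro continuous_intros continuous_on_product_coordinates)
    then have "(g \<longlongrightarrow> g s) (at s)" by (simp add: continuous_on_def)
    then have g: "(g \<longlongrightarrow> 0) (at s)" by (simp add: g_def)
    have "((\<lambda>t. normY (trunc n t) - normY (trunc n s)) \<longlongrightarrow> 0) (at s)"
      by (rule Lim_null_comparison[OF _ g])
        (auto simp: g_def intro!: always_eventually normY_trunc_diff_le)
    then show ?thesis by (simp add: LIM_zero_iff)
  qed
  moreover have "trunc n (trunc n t) = trunc n t" for t :: "nat \<Rightarrow> real" by (auto simp: trunc_def)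
  moreover have "normY (trunc n (\<lambda>j. c * t j)) = c * normY (trunc n t)" if "c \<ge> 0" for c t
  proof -
    have "trunc n (\<lambda>j. c * t j) = (\<lambda>j. c * trunc n t j)" by (auto simp: trunc_def)
    then show ?thesis using norm_scale[OF trunc_mem] that by simp
  qed
  ultimately show ?thesis by (auto simp: homog_funs_def continuous_on_def)
qed

lemma normY_trunc_mono: "m \<le> n \<Longrightarrow> normY (trunc m t) \<le> normY (trunc n t)"
  using solid[OF trunc_mem, of "trunc m t" n t] by (auto simp: trunc_def)

text \<open>Solidity of \<open>Y\<close> gives a pointwise inequality, which the calculus preserves;
  \<open>krivine_restrict\<close> evaluates both sides in \<open>n\<close> variables.\<close>

lemma lattice_tuple_norm_mono:
  assumes "m \<le> n"
  shows "lattice_tuple_norm normY m x \<le> lattice_tuple_norm normY n x"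
proof -
  note k = krivine_map_krivine[of n x]
  have Hm: "(\<lambda>t. normY (trunc m t)) \<in> homog_funs n"
    by (rule homog_funs_mono[OF normY_trunc_homog assms])
  have le: "krivine n x (\<lambda>t. normY (trunc m t)) \<le> krivine n x (\<lambda>t. normY (trunc n t))"
    by (rule krivine_map_mono[OF k Hm normY_trunc_homog normY_trunc_mono[OF assms]])
  \<comment> \<open>The norm is monotone in the modulus, so the smaller element is first shown to be
    nonnegative.\<close>
  have "krivine n x (\<lambda>t. 0) \<le> krivine n x (\<lambda>t. normY (trunc m t))"
    by (rule krivine_map_mono[OF k homog_funs_zero Hm normY_nonneg[OF trunc_mem]])
  then have "0 \<le> krivine n x (\<lambda>t. normY (trunc m t))" by (simp add: krivine_map_zero[OF k])
  then have "norm (krivine n x (\<lambda>t. normY (trunc m t))) \<le> norm (krivine n x (\<lambda>t. normY (trunc n t)))"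
    using le by (intro norm_le_of_bounds) (auto intro: order_trans[of _ 0])
  then show ?thesis
    by (simp add: lattice_tuple_norm_def krivine_restrict[OF assms] normY_trunc_homog)
qed

text \<open>Beyond the support, appended zeros leave the norm unchanged by
  \<open>krivine_comp_trunc\<close>; below it, monotonicity applies.\<close>

lemma lattice_tuple_norm_le_support:
  assumes "\<And>j. n \<le> j \<Longrightarrow> x j = 0"
  shows "lattice_tuple_norm normY m x \<le> lattice_tuple_norm normY n x"
proof (cases "m \<le> n")
  case True
  then show ?thesis by (rule lattice_tuple_norm_mono)
next
  case False
  then have "trunc m (trunc n t) = trunc n t" for t :: "nat \<Rightarrow> real" by (auto simp: trunc_def)
  then show ?thesis
    using krivine_comp_trunc[OF assms normY_trunc_homog[of m]] by (simp add: lattice_tuple_norm_def)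
qed

section \<open>Norms of eventually zero sequences\<close>

lemma ell_tau_norm_finite_support:
  assumes "\<And>j. n \<le> j \<Longrightarrow> x j = 0"
  shows "ell_tau_norm normY x = lattice_tuple_norm normY n x"
  unfolding ell_tau_norm_def
  by (intro cSup_eq_maximum) (auto intro: lattice_tuple_norm_le_support[OF assms])

lemma ell_norm_finite_support:
  assumes "\<And>j. n \<le> j \<Longrightarrow> w j = 0"
  shows "ell_norm normY w = banach_tuple_norm normY n w"
proof -
  have "(\<lambda>j. norm (w j)) = trunc n (\<lambda>j. norm (w j))" using assms by (auto simp: trunc_def)
  then show ?thesis by (simp add: ell_norm_def banach_tuple_norm_def)
qed

text \<open>The tuple norms of an eventually zero sequence are bounded by the one at the end of its
  support, so membership in \<open>ell_tau\<close> is automatic.\<close>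

lemma ell00_tau_iff: "x \<in> ell00_tau normY \<longleftrightarrow> (\<exists>n. \<forall>j\<ge>n. x j = 0)"
  unfolding ell00_tau_def ell_tau_def eventually_sequentially
  by (auto intro!: bdd_aboveI2 lattice_tuple_norm_le_support)

lemma ell00_iff: "w \<in> ell00 Y \<longleftrightarrow> (\<exists>n. \<forall>j\<ge>n. w j = 0)"
proof -
  have "(\<lambda>j. norm (w j)) \<in> Y" if "\<forall>j\<ge>n. w j = 0" for n
  proof -
    have "(\<lambda>j. norm (w j)) = trunc n (\<lambda>j. norm (w j))" using that by (auto simp: trunc_def)
    then show ?thesis using trunc_mem by metis
  qed
  then show ?thesis by (auto simp: ell00_def ell_def eventually_sequentially)
qed

lemma ell_norm_nonneg: "w \<in> ell00 Y \<Longrightarrow> 0 \<le> ell_norm normY w"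
  by (auto simp: ell00_def ell_def ell_norm_def intro: normY_nonneg)

lemma ell_tau_norm_nonneg: "x \<in> ell00_tau normY \<Longrightarrow> 0 \<le> ell_tau_norm normY x"
  using ell_tau_norm_finite_support lattice_tuple_norm_nonneg by (metis ell00_tau_iff)

lemma banach_tuple_norm_trunc: "banach_tuple_norm normY n (trunc n w) = banach_tuple_norm normY n w"
  by (auto simp: banach_tuple_norm_def trunc_def intro!: arg_cong[of _ _ normY])

lemma lattice_tuple_norm_trunc: "lattice_tuple_norm normY n (trunc n x) = lattice_tuple_norm normY n x"
  by (rule lattice_tuple_norm_cong) (simp add: trunc_def)

text \<open>A tuple corresponds to its truncation, and \<open>T 0 = 0\<close> makes \<open>T\<close>
  commute with truncation. Conversely, an eventually zero sequence is a tuple as long as its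
  support, and both sequence norms become tuple norms.\<close>

lemma convex_bound_iff:
  assumes "linear T"
  shows "convex_bound normY T C \<longleftrightarrow>
    C > 0 \<and> (\<forall>w\<in>ell00 Y. ell_tau_norm normY (seq_op T w) \<le> C * ell_norm normY w)"
proof -
  have T0: "T 0 = 0" by (rule linear_0[OF assms])
  have "lattice_tuple_norm normY n (\<lambda>j. T (w j)) \<le> C * banach_tuple_norm normY n w"
    if b: "\<forall>w\<in>ell00 Y. ell_tau_norm normY (seq_op T w) \<le> C * ell_norm normY w" for n w
  proof -
    have "trunc n w \<in> ell00 Y" by (auto simp: ell00_iff trunc_def intro!: exI[of _ n])
    then have "ell_tau_norm normY (seq_op T (trunc n w)) \<le> C * ell_norm normY (trunc n w)"
      using b by blast
    moreover have "seq_op T (trunc n w) = trunc n (\<lambda>j. T (w j))"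
      by (auto simp: seq_op_def trunc_def T0)
    ultimately show ?thesis
      by (simp add: ell_tau_norm_finite_support[of n] ell_norm_finite_support[of n]
          lattice_tuple_norm_trunc banach_tuple_norm_trunc trunc_def[of n, THEN fun_cong])
  qed
  moreover have "ell_tau_norm normY (seq_op T w) \<le> C * ell_norm normY w"
    if b: "\<forall>n w. lattice_tuple_norm normY n (\<lambda>j. T (w j)) \<le> C * banach_tuple_norm normY n w"
      and w: "w \<in> ell00 Y" for w
  proof -
    obtain n where n: "\<And>j. n \<le> j \<Longrightarrow> w j = 0" using w by (auto simp: ell00_iff)
    then show ?thesis
      using b by (simp add: ell_tau_norm_finite_support[of n] ell_norm_finite_support[of n] seq_op_def T0)
  qed
  ultimately show ?thesis unfolding convex_bound_def by blast
qed

text \<open>Tuples and truncations correspond as for convexity, with the two norms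
  exchanged.\<close>

lemma concave_bound_iff:
  assumes "linear S"
  shows "concave_bound normY S K \<longleftrightarrow>
    K > 0 \<and> (\<forall>x\<in>ell00_tau normY. ell_norm normY (seq_op S x) \<le> K * ell_tau_norm normY x)"
proof -
  have S0: "S 0 = 0" by (rule linear_0[OF assms])
  have "banach_tuple_norm normY n (\<lambda>j. S (x j)) \<le> K * lattice_tuple_norm normY n x"
    if b: "\<forall>x\<in>ell00_tau normY. ell_norm normY (seq_op S x) \<le> K * ell_tau_norm normY x" for n x
  proof -
    have "trunc n x \<in> ell00_tau normY" by (auto simp: ell00_tau_iff trunc_def intro!: exI[of _ n])
    then have "ell_norm normY (seq_op S (trunc n x)) \<le> K * ell_tau_norm normY (trunc n x)"
      using b by blast
    moreover have "seq_op S (trunc n x) = trunc n (\<lambda>j. S (x j))"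
      by (auto simp: seq_op_def trunc_def S0)
    ultimately show ?thesis
      by (simp add: ell_tau_norm_finite_support[of n] ell_norm_finite_support[of n]
          lattice_tuple_norm_trunc banach_tuple_norm_trunc trunc_def[of n, THEN fun_cong])
  qed
  moreover have "ell_norm normY (seq_op S x) \<le> K * ell_tau_norm normY x"
    if b: "\<forall>n x. banach_tuple_norm normY n (\<lambda>j. S (x j)) \<le> K * lattice_tuple_norm normY n x"
      and x: "x \<in> ell00_tau normY" for x
  proof -
    obtain n where n: "\<And>j. n \<le> j \<Longrightarrow> x j = 0" using x by (auto simp: ell00_tau_iff)
    then show ?thesis
      using b by (simp add: ell_tau_norm_finite_support[of n] ell_norm_finite_support[of n] seq_op_def S0)
  qed
  ultimately show ?thesis unfolding concave_bound_def by blast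
qed

end

section \<open>Boundedness and the operator norm through positive bounds\<close>

text \<open>The convexity and concavity bounds ask for positive constants; any \<open>C\<close> may
  be replaced by \<open>\<bar>C\<bar> + 1\<close> because the norm on \<open>V\<close> is
  nonnegative.\<close>

lemma bounded_op_on_iff_pos_bound:
  assumes "F ` V \<subseteq> W" "\<And>v. v \<in> V \<Longrightarrow> 0 \<le> nV v"
  shows "bounded_op_on V nV W nW F \<longleftrightarrow> (\<exists>C>0. \<forall>v\<in>V. nW (F v) \<le> C * nV v)"
proof -
  have "\<forall>v\<in>V. nW (F v) \<le> (\<bar>C\<bar> + 1) * nV v" if "\<forall>v\<in>V. nW (F v) \<le> C * nV v" for C
  proof
    fix v assume v: "v \<in> V"
    have "C * nV v \<le> (\<bar>C\<bar> + 1) * nV v" by (intro mult_right_mono assms v) auto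
    then show "nW (F v) \<le> (\<bar>C\<bar> + 1) * nV v" using that v by force
  qed
  moreover have "\<bar>C\<bar> + 1 > 0" for C :: real by simp
  ultimately show ?thesis unfolding bounded_op_on_def using assms(1) by blast
qed

text \<open>Each bound dominates every quotient, including the value 0 at vectors of norm zero;
  conversely, the supremum of the quotients plus any \<open>e > 0\<close> is a bound.\<close>

lemma op_norm_on_eq_Inf:
  assumes V: "V \<noteq> {}" "\<And>v. v \<in> V \<Longrightarrow> 0 \<le> nV v" "\<And>v. v \<in> V \<Longrightarrow> 0 \<le> nW (F v)"
    and ex: "\<exists>C>0. \<forall>v\<in>V. nW (F v) \<le> C * nV v"
  shows "op_norm_on V nV nW F = Inf {C. C > 0 \<and> (\<forall>v\<in>V. nW (F v) \<le> C * nV v)}"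
proof -
  define B where "B = {C. C > 0 \<and> (\<forall>v\<in>V. nW (F v) \<le> C * nV v)}"
  define s where "s = op_norm_on V nV nW F"
  obtain C0 where C0: "C0 \<in> B" using ex by (auto simp: B_def)
  have ratio: "nW (F v) / nV v \<le> C" if "C \<in> B" "v \<in> V" for C v
  proof (cases "nV v = 0")
    case True
    then show ?thesis using that by (simp add: B_def)
  next
    case False
    then have "nV v > 0" using V(2)[OF that(2)] by simp
    then show ?thesis using that by (simp add: B_def pos_divide_le_eq)
  qed
  have bdd: "bdd_above ((\<lambda>v. nW (F v) / nV v) ` V)" using ratio[OF C0] by (rule bdd_aboveI2)
  have upper: "nW (F v) / nV v \<le> s" if "v \<in> V" for v
    unfolding s_def op_norm_on_def by (rule cSUP_upper[OF that bdd])
  have s0: "0 \<le> s"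
  proof -
    obtain v where v: "v \<in> V" using V by auto
    then have "0 \<le> nW (F v) / nV v" using V by simp
    then show ?thesis using upper[OF v] by linarith
  qed
  have bddB: "bdd_below B" by (rule bdd_belowI[of _ 0]) (auto simp: B_def)
  have "s \<le> Inf B"
    by (rule cInf_greatest)
      (use C0 V in \<open>auto simp: s_def op_norm_on_def intro!: cSUP_least ratio\<close>)
  moreover have "Inf B \<le> s"
  proof (rule field_le_epsilon)
    \<comment> \<open>The supremum \<open>s\<close> may be 0 while members of \<open>B\<close> are
      positive, so \<open>s + e\<close> is used.\<close>
    fix e :: real assume e: "e > 0"
    have "nW (F v) \<le> (s + e) * nV v" if v: "v \<in> V" for v
    proof (cases "nV v = 0")
      \<comment> \<open>The quotient is 0 by convention and says nothing about
        \<open>nW (F v)\<close>; the bound \<open>C0\<close> shows that this is at most 0.\<close>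
      case True
      then show ?thesis using C0 v by (auto simp: B_def)
    next
      case False
      then have pos: "nV v > 0" using V(2)[OF v] by simp
      then have "nW (F v) \<le> s * nV v" using upper[OF v] by (simp add: pos_divide_le_eq)
      also have "\<dots> \<le> (s + e) * nV v" using pos e by (intro mult_right_mono) auto
      finally show ?thesis .
    qed
    then have "s + e \<in> B" using s0 e by (simp add: B_def)
    then show "Inf B \<le> s + e" by (rule cInf_lower[OF _ bddB])
  qed
  ultimately show ?thesis by (simp add: s_def B_def)
qed

theorem proposition23:
  fixes Y :: "(nat \<Rightarrow> real) set" and normY :: "(nat \<Rightarrow> real) \<Rightarrow> real"
  assumes "banach_sequence_lattice Y normY"
  shows "(\<forall>T :: 'e::banach \<Rightarrow> 'x::banach_lattice. linear T \<longrightarrow>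
      (Y_convex normY T \<longleftrightarrow>
        bounded_op_on (ell00 Y) (ell_norm normY) (ell00_tau normY) (ell_tau_norm normY) (seq_op T)) \<and>
      (Y_convex normY T \<longrightarrow>
        op_norm_on (ell00 Y) (ell_norm normY) (ell_tau_norm normY) (seq_op T) = convexity_const normY T)) \<and>
    (\<forall>S :: 'x \<Rightarrow> 'e. linear S \<longrightarrow>
      (Y_concave normY S \<longleftrightarrow>
        bounded_op_on (ell00_tau normY) (ell_tau_norm normY) (ell00 Y) (ell_norm normY) (seq_op S)) \<and>
      (Y_concave normY S \<longrightarrow>
        op_norm_on (ell00_tau normY) (ell_tau_norm normY) (ell_norm normY) (seq_op S) = concavity_const normY S))"
proof -
  interpret banach_sequence_lattice Y normY by fact
  show ?thesis
  proof (intro conjI allI impI)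
    fix T :: "'e \<Rightarrow> 'x" assume T: "linear T"
    have img: "seq_op T ` ell00 Y \<subseteq> ell00_tau normY"
      using linear_0[OF T] by (auto simp: ell00_iff ell00_tau_iff seq_op_def) metis
    have ne: "ell00 Y \<noteq> ({} :: (nat \<Rightarrow> 'e) set)"
      using ell00_iff[of "\<lambda>j. 0 :: 'e"] by auto
    show "Y_convex normY T \<longleftrightarrow>
        bounded_op_on (ell00 Y) (ell_norm normY) (ell00_tau normY) (ell_tau_norm normY) (seq_op T)"
      by (simp add: bounded_op_on_iff_pos_bound[OF img ell_norm_nonneg] Y_convex_def convex_bound_iff[OF T])
    assume "Y_convex normY T"
    then show "op_norm_on (ell00 Y) (ell_norm normY) (ell_tau_norm normY) (seq_op T) = convexity_const normY T"
      unfolding convexity_const_def Y_convex_def convex_bound_iff[OF T]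
      by (intro op_norm_on_eq_Inf ne ell_norm_nonneg ell_tau_norm_nonneg) (use img in auto)
  next
    fix S :: "'x \<Rightarrow> 'e" assume S: "linear S"
    have img: "seq_op S ` ell00_tau normY \<subseteq> ell00 Y"
      using linear_0[OF S] by (auto simp: ell00_iff ell00_tau_iff seq_op_def) metis
    have ne: "ell00_tau normY \<noteq> ({} :: (nat \<Rightarrow> 'x) set)"
      using ell00_tau_iff[of "\<lambda>j. 0 :: 'x"] by auto
    show "Y_concave normY S \<longleftrightarrow>
        bounded_op_on (ell00_tau normY) (ell_tau_norm normY) (ell00 Y) (ell_norm normY) (seq_op S)"
      by (simp add: bounded_op_on_iff_pos_bound[OF img ell_tau_norm_nonneg] Y_concave_def
          concave_bound_iff[OF S])
    assume "Y_concave normY S"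
    then show "op_norm_on (ell00_tau normY) (ell_tau_norm normY) (ell_norm normY) (seq_op S) = concavity_const normY S"
      unfolding concavity_const_def Y_concave_def concave_bound_iff[OF S]
      by (intro op_norm_on_eq_Inf ne ell_norm_nonneg ell_tau_norm_nonneg) (use img in auto)
  qed
qed

end
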